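(* For every integer $p\ge 2$ there is a constant $C_p>0$, depending only on $p$, and an algorithm using the $p$th-order oracle such that the following holds. Let $\mathcal X\subseteq\mathbb R^d$ be a nonempty compact convex set, let $F:\mathbb R^d\to\mathbb R^d$ be continuous, monotone on $\mathcal X$ and $p$th-order $L_p$-smooth on $\mathcal X$ with $L_p>0$, and let $x^*$ satisfy $0\in F(x^* )+\mathcal N_{\mathcal X}(x^* )$. Let $x_0\in\mathcal X$ with $D=\|x_0-x^*\|>0$, and let $\epsilon>0$. Then the algorithm, run from $x_0$, returns an $\epsilon$-solution $x\in\mathcal X$, i.e. a point with $$\operatorname{dist}\bigl(0,\;F(x)+\mathcal N_{\mathcal X}(x)\bigr)\le\epsilon,$$ after a number $T$ of $p$th-order oracle calls satisfying $$T\le C_p\,\max\Bigl\{1,\Bigl(\frac{L_pD^p}{\epsilon}\Bigr)^{2/(3p-1)}\Bigr\}.$$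
   Context: $\|\cdot\|$ is the Euclidean norm for vectors and the spectral (operator) norm for matrices and tensors. $\mathcal N_{\mathcal X}(x)=\{n\in\mathbb R^d:\langle n,y-x\rangle\le 0\ \forall y\in\mathcal X\}$ is the normal cone of $\mathcal X$ at $x\in\mathcal X$, and $\operatorname{dist}(0,S)=\inf_{s\in S}\|s\|$. Monotone on $\mathcal X$: $\langle F(x)-F(y),x-y\rangle\ge 0$ for all $x,y\in\mathcal X$. $p$th-order $L_p$-smooth on $\mathcal X$: $F$ has continuous derivatives up to order $p-1$, and $\|D^{p-1}F(x)-D^{p-1}F(y)\|\le L_p\|x-y\|$ for all $x,y\in\mathcal X$, where $D^qF$ denotes the $q$th derivative of $F$. The $p$th-order oracle, queried at a point $x$, returns $(F(x),DF(x),\dots,D^{p-1}F(x))$. An algorithm using this oracle is a deterministic adaptive procedure that knows $p$, $L_p$, $D$, $\mathcal X$, $x_0$ and $\epsilon$, but accesses $F$ only through oracle answers: each query point, the decision to stop, and the output are determined by the known data and the answers received so far. Complexity is the number of oracle calls; computations between calls (for example, solving variational inequalities built from the Taylor polynomials already obtained) are not counted. *)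

theory Defs
  imports "HOL-Analysis.Analysis"
begin

section \<open>Euclidean spaces of variable dimension\<close>

text \<open>
  The constant of the theorem must not depend on the dimension, so the dimension has to be
  quantified inside the formula and cannot be a type. All spaces of coordinate vectors are therefore
  placed inside one inner product space, the finitely supported real sequences; the space of
  dimension \<open>d\<close> is the subspace \<open>Rn d\<close> of sequences vanishing from index \<open>d\<close> on.
\<close>

typedef fvec = "{f :: nat \<Rightarrow> real. finite {i. f i \<noteq> 0}}"
  morphisms coord Abs_fvec
  by (rule exI [of _ "\<lambda>_. 0"]) simp

setup_lifting type_definition_fvec

lemma finite_support_coord: "finite {i. coord x i \<noteq> 0}"
  using coord by auto

lemma fvec_eqI: "(\<And>i. coord x i = coord y i) \<Longrightarrow> x = y"
  by (metis coord_inject ext)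

instantiation fvec :: real_vector
begin

lift_definition zero_fvec :: fvec is "\<lambda>_. 0" by simp

lift_definition plus_fvec :: "fvec \<Rightarrow> fvec \<Rightarrow> fvec" is "\<lambda>f g i. f i + g i"
proof -
  fix f g :: "nat \<Rightarrow> real"
  assume "finite {i. f i \<noteq> 0}" "finite {i. g i \<noteq> 0}"
  then show "finite {i. f i + g i \<noteq> 0}"
    by (rule_tac finite_subset [of _ "{i. f i \<noteq> 0} \<union> {i. g i \<noteq> 0}"]) auto
qed

lift_definition minus_fvec :: "fvec \<Rightarrow> fvec \<Rightarrow> fvec" is "\<lambda>f g i. f i - g i"
proof -
  fix f g :: "nat \<Rightarrow> real"
  assume "finite {i. f i \<noteq> 0}" "finite {i. g i \<noteq> 0}"
  then show "finite {i. f i - g i \<noteq> 0}"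
    by (rule_tac finite_subset [of _ "{i. f i \<noteq> 0} \<union> {i. g i \<noteq> 0}"]) auto
qed

lift_definition uminus_fvec :: "fvec \<Rightarrow> fvec" is "\<lambda>f i. - f i" by simp

lift_definition scaleR_fvec :: "real \<Rightarrow> fvec \<Rightarrow> fvec" is "\<lambda>r f i. r * f i"
  by (rule finite_subset) auto

instance
  by standard (transfer; auto simp: algebra_simps fun_eq_iff)+

end

lemma coord_simps [simp]:
  "coord 0 i = 0" "coord (x + y) i = coord x i + coord y i"
  "coord (x - y) i = coord x i - coord y i" "coord (- x) i = - coord x i"
  "coord (r *\<^sub>R x) i = r * coord x i"
  by (transfer; simp)+

instantiation fvec :: real_inner
begin

definition inner_fvec :: "fvec \<Rightarrow> fvec \<Rightarrow> real"
  where "inner_fvec x y = (\<Sum>i | coord x i \<noteq> 0. coord x i * coord y i)"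

definition norm_fvec :: "fvec \<Rightarrow> real"
  where "norm_fvec x = sqrt (inner x x)"

definition dist_fvec :: "fvec \<Rightarrow> fvec \<Rightarrow> real"
  where "dist_fvec x y = norm (x - y)"

definition sgn_fvec :: "fvec \<Rightarrow> fvec"
  where "sgn_fvec x = x /\<^sub>R norm x"

definition uniformity_fvec :: "(fvec \<times> fvec) filter"
  where "uniformity_fvec = (INF e\<in>{0<..}. principal {(x, y). dist x y < e})"

definition open_fvec :: "fvec set \<Rightarrow> bool"
  where "open_fvec U \<longleftrightarrow> (\<forall>x\<in>U. \<forall>\<^sub>F (x', y) in uniformity. x' = x \<longrightarrow> y \<in> U)"

lemma inner_fvec_superset:
  assumes "finite A" "{i. coord x i \<noteq> 0} \<subseteq> A"
  shows "inner x y = (\<Sum>i\<in>A. coord x i * coord y i)"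
  unfolding inner_fvec_def using assms by (intro sum.mono_neutral_left) auto

instance
proof
  fix x y z :: fvec and r :: real
  let ?A = "{i. coord x i \<noteq> 0} \<union> {i. coord y i \<noteq> 0} \<union> {i. coord z i \<noteq> 0}"
  have fin: "finite ?A"
    by (simp add: finite_support_coord)
  have eq: "inner u v = (\<Sum>i\<in>?A. coord u i * coord v i)" if "{i. coord u i \<noteq> 0} \<subseteq> ?A" for u v
    by (rule inner_fvec_superset [OF fin that])
  show "inner x y = inner y x"
    by (subst (1 2) eq) (auto simp: mult.commute)
  show "inner (x + y) z = inner x z + inner y z"
    by (subst (1 2 3) eq) (auto simp: sum.distrib algebra_simps)
  show "inner (r *\<^sub>R x) y = r * inner x y"
    by (subst (1 2) eq) (auto simp: sum_distrib_left algebra_simps)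
  show "0 \<le> inner x x"
    unfolding inner_fvec_def by (intro sum_nonneg) simp
  show "inner x x = 0 \<longleftrightarrow> x = 0"
  proof
    assume "inner x x = 0"
    then have "\<forall>i\<in>{i. coord x i \<noteq> 0}. coord x i * coord x i = 0"
      unfolding inner_fvec_def
      by (subst (asm) sum_nonneg_eq_0_iff) (auto simp: finite_support_coord)
    then show "x = 0"
      by (intro fvec_eqI) auto
  qed (simp add: inner_fvec_def)
qed (simp_all add: norm_fvec_def dist_fvec_def sgn_fvec_def uniformity_fvec_def open_fvec_def)

end

definition Rn :: "nat \<Rightarrow> fvec set"
  where "Rn d = {x. \<forall>i\<ge>d. coord x i = 0}"

lemma inner_Rn:
  assumes "x \<in> Rn d"
  shows "inner x y = (\<Sum>i<d. coord x i * coord y i)"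
  by (rule inner_fvec_superset) (use assms in \<open>auto simp: Rn_def not_le [symmetric]\<close>)

lemma norm_Rn:
  assumes "x \<in> Rn d"
  shows "norm x = sqrt (\<Sum>i<d. (coord x i)\<^sup>2)"
  by (simp add: norm_eq_sqrt_inner inner_Rn [OF assms] power2_eq_square)

section \<open>Variational inequalities\<close>

definition normal_cone :: "nat \<Rightarrow> fvec set \<Rightarrow> fvec \<Rightarrow> fvec set"
  where "normal_cone d X x = {n \<in> Rn d. \<forall>y\<in>X. inner n (y - x) \<le> 0}"

definition VI_residual_set :: "nat \<Rightarrow> fvec set \<Rightarrow> (fvec \<Rightarrow> fvec) \<Rightarrow> fvec \<Rightarrow> fvec set"
  where "VI_residual_set d X F x = {F x + n | n. n \<in> normal_cone d X x}"

definition monotone_operator_on :: "fvec set \<Rightarrow> (fvec \<Rightarrow> fvec) \<Rightarrow> bool"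
  where "monotone_operator_on X F \<longleftrightarrow> (\<forall>x\<in>X. \<forall>y\<in>X. 0 \<le> inner (F x - F y) (x - y))"

section \<open>Higher derivatives\<close>

text \<open>
  A \<open>q\<close>-linear map on \<open>Rn d\<close> is represented by its values on lists of \<open>q\<close> direction vectors;
  values on other lists carry no meaning.
\<close>

type_synonym tensor = "fvec list \<Rightarrow> fvec"

definition directions :: "nat \<Rightarrow> nat \<Rightarrow> fvec list set"
  where "directions d q = {hs. length hs = q \<and> set hs \<subseteq> Rn d}"

definition tensor_norm :: "nat \<Rightarrow> nat \<Rightarrow> tensor \<Rightarrow> real"
  where "tensor_norm d q A = (SUP hs \<in> {hs \<in> directions d q. \<forall>h\<in>set hs. norm h \<le> 1}. norm (A hs))"

text \<open>
  \<open>derivatives_on d U p F DF\<close>: on the relatively open set \<open>U\<close>, the maps \<open>DF 0, \<dots>, DF (p - 1)\<close>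
  are the derivatives of \<open>F\<close> of order \<open>0, \<dots>, p - 1\<close>, and they are continuous. The derivative of
  order \<open>Suc q\<close> is the Frechet derivative within \<open>Rn d\<close> of the one of order \<open>q\<close>; since \<open>Rn d\<close> has
  finite dimension, it may be taken separately for each list of directions, and likewise for
  continuity. Only the values of the derivative on \<open>Rn d\<close> are determined, hence the auxiliary \<open>A\<close>.
  Multilinearity of \<open>DF q x\<close> on \<open>Rn d\<close> and uniqueness are consequences for \<open>x \<in> U\<close>. Outside \<open>U\<close>
  only the value \<open>F x\<close> of order \<open>0\<close> is prescribed.
\<close>

definition derivatives_on ::
    "nat \<Rightarrow> fvec set \<Rightarrow> nat \<Rightarrow> (fvec \<Rightarrow> fvec) \<Rightarrow> (nat \<Rightarrow> fvec \<Rightarrow> tensor) \<Rightarrow> bool"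
  where "derivatives_on d U p F DF \<longleftrightarrow>
    (\<forall>x\<in>Rn d. DF 0 x [] = F x) \<and>
    (\<forall>q. Suc q < p \<longrightarrow> (\<forall>x\<in>U. \<forall>hs\<in>directions d q.
       \<exists>A. ((\<lambda>y. DF q y hs) has_derivative A) (at x within Rn d) \<and>
           (\<forall>h\<in>Rn d. A h = DF (Suc q) x (h # hs)))) \<and>
    (\<forall>q<p. \<forall>hs\<in>directions d q. continuous_on U (\<lambda>y. DF q y hs))"

text \<open>
  Derivatives are required on some neighbourhood of \<open>X\<close> in \<open>Rn d\<close> (possibly all of \<open>Rn d\<close>), so that
  they are well defined at every point of \<open>X\<close> even if \<open>X\<close> has empty interior.
\<close>

definition smooth_operator_on ::
    "nat \<Rightarrow> fvec set \<Rightarrow> nat \<Rightarrow> real \<Rightarrow> (fvec \<Rightarrow> fvec) \<Rightarrow> (nat \<Rightarrow> fvec \<Rightarrow> tensor) \<Rightarrow> bool"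
  where "smooth_operator_on d X p L F DF \<longleftrightarrow>
    (\<exists>U. openin (top_of_set (Rn d)) U \<and> X \<subseteq> U \<and> derivatives_on d U p F DF) \<and>
    (\<forall>x\<in>X. \<forall>y\<in>X.
       tensor_norm d (p - 1) (\<lambda>hs. DF (p - 1) x hs - DF (p - 1) y hs) \<le> L * norm (x - y))"

section \<open>Algorithms with access to derivatives\<close>

type_synonym answer = "tensor list"

definition jet_oracle :: "nat \<Rightarrow> (nat \<Rightarrow> fvec \<Rightarrow> tensor) \<Rightarrow> fvec \<Rightarrow> answer"
  where "jet_oracle p DF x = map (\<lambda>q. DF q x) [0..<p]"

datatype action = Query fvec | Return fvec

text \<open>
  The next action depends only on the known data and on the list of answers received so far (oldest
  first). The known data are, in this order, the dimension, the smoothness constant, the initial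
  distance, the feasible set, the starting point and the accuracy; the order \<open>p\<close> is fixed before the
  algorithm is chosen.
\<close>

type_synonym strategy = "answer list \<Rightarrow> action"
type_synonym algorithm = "nat \<Rightarrow> real \<Rightarrow> real \<Rightarrow> fvec set \<Rightarrow> fvec \<Rightarrow> real \<Rightarrow> strategy"

text \<open>
  \<open>returns V orc s as T x\<close>: having received the answers \<open>as\<close>, the strategy \<open>s\<close> makes exactly \<open>T\<close>
  further calls of \<open>orc\<close>, all at points of \<open>V\<close>, and then stops with output \<open>x\<close>.
\<close>

inductive returns ::
    "fvec set \<Rightarrow> (fvec \<Rightarrow> answer) \<Rightarrow> strategy \<Rightarrow> answer list \<Rightarrow> nat \<Rightarrow> fvec \<Rightarrow> bool"
  for V :: "fvec set" and orc :: "fvec \<Rightarrow> answer" and s :: strategy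
where
  stop: "s as = Return x \<Longrightarrow> returns V orc s as 0 x"
| call: "s as = Query z \<Longrightarrow> z \<in> V \<Longrightarrow> returns V orc s (as @ [orc z]) T x
         \<Longrightarrow> returns V orc s as (Suc T) x"

end

theory Submission
  imports Defs
begin

text \<open>
  The method discretises the anchored flow: from a point \<open>x\<close> with residual \<open>g \<in> F(x) + N(x)\<close> and an
  anchor weight \<open>A\<close>, a step of size \<open>a\<close> is the inexact proximal step
  \<open>(A + a) (x' - x0) = A (x - x0) - a A (g' - e)\<close> with \<open>g' \<in> F(x') + N(x')\<close> and an error \<open>e\<close> that is
  small compared with \<open>g' - g\<close>. Monotonicity alone makes the potential
  \<open>A \<langle>g, x - x0\<rangle> + A\<^sup>2 \<parallel>g\<parallel>\<^sup>2 / 2\<close> decrease up to a summable error, and this has two consequences: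
  \<open>\<parallel>g\<parallel>\<close> is of order \<open>D / A\<close>, and the energy \<open>\<Sum> A\<^sup>2 \<parallel>g' - g\<parallel>\<^sup>2\<close> is of order \<open>D\<^sup>2\<close>
  (\<open>anchored_step_decrease\<close>, \<open>potential_lower_bound\<close>).

  The second bound is the source of the rate. As \<open>g\<close> is known, the end point of the step is predicted by
  replacing \<open>g'\<close> by \<open>g\<close>, and it misses the prediction by about \<open>a \<parallel>g' - g\<parallel>\<close>, which is much less than the
  length \<open>a \<parallel>g'\<parallel>\<close> of the step. The oracle is called at the prediction, and the step is solved with the
  Taylor polynomial \<open>T\<close> found there in place of \<open>F\<close>. The remainder of order \<open>p\<close> is an admissible error
  when the end point lies within the radius \<open>\<rho>(a)\<close> of the prediction, which is a constant
  times \<open>1 / (L a)\<close> to the power \<open>1 / (p - 1)\<close>.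

  If no such end point exists, the step is replaced by its two halves. Rejections are paid for by energy:
  were \<open>g\<close> to change little over two accepted halves, these would nearly solve the equation of the full
  step, and strong monotonicity would bring the exact full step within \<open>\<rho>(a)\<close> of the prediction
  (\<open>half_steps_predict_full_step\<close>, \<open>rejection_charges_energy\<close>). A rejected step therefore costs energy
  of order \<open>A\<^sup>2 (\<rho>(a) / a)\<^sup>2\<close>. This grows at least fourfold with every halving, so the number of oracle calls spent
  on a step is bounded by its energy divided by that price, plus a constant (\<open>advance_by_bisection\<close>).

  With anchor weights proportional to \<open>i\<close> to the power \<open>(3 p - 1) / 2\<close> the price at index \<open>i\<close> is at least \<open>D\<^sup>2 / i\<close>.
  Hence \<open>O(K)\<close> calls suffice for the first \<open>K\<close> indices, after which the residual is of order \<open>D\<close> divided by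
  the \<open>K\<close>-th weight. Solving for \<open>K\<close> gives the exponent \<open>2 / (3 p - 1)\<close>.
\<close>

section \<open>Vectors and multilinear maps\<close>

lemma Rn_add: "x \<in> Rn d \<Longrightarrow> y \<in> Rn d \<Longrightarrow> x + y \<in> Rn d"
  and Rn_diff: "x \<in> Rn d \<Longrightarrow> y \<in> Rn d \<Longrightarrow> x - y \<in> Rn d"
  and Rn_minus: "x \<in> Rn d \<Longrightarrow> - x \<in> Rn d"
  and Rn_scaleR: "x \<in> Rn d \<Longrightarrow> r *\<^sub>R x \<in> Rn d"
  and Rn_zero: "0 \<in> Rn d"
  by (auto simp: Rn_def)

lemmas Rn_closed = Rn_add Rn_diff Rn_minus Rn_scaleR Rn_zero

lift_definition unit_vector :: "nat \<Rightarrow> fvec" is "\<lambda>i j. if j = i then 1 else 0"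
  by simp

lemma coord_unit_vector [simp]: "coord (unit_vector i) j = (if j = i then 1 else 0)"
  by transfer simp

lemma unit_vector_in_Rn: "i < d \<Longrightarrow> unit_vector i \<in> Rn d"
  by (auto simp: Rn_def)

lemma coord_sum [simp]: "coord (\<Sum>i\<in>I. f i) j = (\<Sum>i\<in>I. coord (f i) j)"
  by (induction I rule: infinite_finite_induct) auto

lemma Rn_basis_expansion: "h \<in> Rn d \<Longrightarrow> h = (\<Sum>i<d. coord h i *\<^sub>R unit_vector i)"
  by (rule fvec_eqI) (auto simp: Rn_def not_le[symmetric] if_distrib cong: if_cong)

lemma coord_le_norm: "\<bar>coord h i\<bar> \<le> norm h"
proof (cases "coord h i = 0")
  case False
  have "(coord h i)\<^sup>2 \<le> (\<Sum>j | coord h j \<noteq> 0. coord h j * coord h j)"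
    using member_le_sum[of i "{j. coord h j \<noteq> 0}" "\<lambda>j. coord h j * coord h j"] False
    by (auto simp: finite_support_coord power2_eq_square)
  also have "\<dots> = (norm h)\<^sup>2"
    by (simp add: power2_norm_eq_inner inner_fvec_def)
  finally show ?thesis
    by (metis abs_le_square_iff abs_norm_cancel)
qed auto

definition linear_on_Rn :: "nat \<Rightarrow> (fvec \<Rightarrow> fvec) \<Rightarrow> bool"
  where "linear_on_Rn d f \<longleftrightarrow>
    (\<forall>h\<in>Rn d. \<forall>k\<in>Rn d. f (h + k) = f h + f k) \<and> (\<forall>h\<in>Rn d. \<forall>r. f (r *\<^sub>R h) = r *\<^sub>R f h)"

fun multilinear_on_Rn :: "nat \<Rightarrow> nat \<Rightarrow> tensor \<Rightarrow> bool"
  where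
    "multilinear_on_Rn d 0 f = True"
  | "multilinear_on_Rn d (Suc q) f \<longleftrightarrow>
       (\<forall>hs\<in>directions d q. linear_on_Rn d (\<lambda>h. f (h # hs))) \<and>
       (\<forall>h\<in>Rn d. multilinear_on_Rn d q (\<lambda>hs. f (h # hs)))"

lemma Cons_in_directions [simp]:
  "h # hs \<in> directions d (Suc q) \<longleftrightarrow> h \<in> Rn d \<and> hs \<in> directions d q"
  by (auto simp: directions_def)

lemma linear_on_Rn_sum:
  assumes "linear_on_Rn d f" "\<And>i. i \<in> I \<Longrightarrow> v i \<in> Rn d" 
  shows "f (\<Sum>i\<in>I. c i *\<^sub>R v i) = (\<Sum>i\<in>I. c i *\<^sub>R f (v i))"
proof -
  have zero: "f 0 = 0"
    using assms(1) Rn_zero[of d] unfolding linear_on_Rn_def by (metis scaleR_zero_left)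
  have "(\<Sum>i\<in>I. c i *\<^sub>R v i) \<in> Rn d \<and> f (\<Sum>i\<in>I. c i *\<^sub>R v i) = (\<Sum>i\<in>I. c i *\<^sub>R f (v i))"
    using assms
    by (induction I rule: infinite_finite_induct) (auto simp: zero Rn_closed linear_on_Rn_def)
  then show ?thesis ..
qed

text \<open>
  Each equation of multilinearity involves finitely many values, so it survives pointwise limits.
  This is how it passes from a derivative of order \<open>q\<close> to the one of order \<open>q + 1\<close>, a limit of
  difference quotients.
\<close>

lemma multilinear_on_Rn_limit:
  assumes "F \<noteq> bot" "\<forall>\<^sub>F t in F. multilinear_on_Rn d q (f t)"
    and "\<And>hs. hs \<in> directions d q \<Longrightarrow> ((\<lambda>t. f t hs) \<longlongrightarrow> g hs) F"
  shows "multilinear_on_Rn d q g"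
  using assms
proof (induction q arbitrary: f g)
  case (Suc q)
  have lim: "((\<lambda>t. f t (h # hs)) \<longlongrightarrow> g (h # hs)) F" if "h \<in> Rn d" "hs \<in> directions d q" for h hs
    using Suc.prems(3) that by simp
  have "linear_on_Rn d (\<lambda>h. g (h # hs))" if hs: "hs \<in> directions d q" for hs
    unfolding linear_on_Rn_def
  proof (intro conjI ballI allI)
    fix h k assume hk: "h \<in> Rn d" "k \<in> Rn d"
    have "\<forall>\<^sub>F t in F. f t (h # hs) + f t (k # hs) = f t ((h + k) # hs)"
      using Suc.prems(2) by eventually_elim (use hs hk in \<open>auto simp: linear_on_Rn_def\<close>)
    moreover have "((\<lambda>t. f t (h # hs) + f t (k # hs)) \<longlongrightarrow> g (h # hs) + g (k # hs)) F"
      by (intro tendsto_add lim hs hk)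
    ultimately have "((\<lambda>t. f t ((h + k) # hs)) \<longlongrightarrow> g (h # hs) + g (k # hs)) F"
      by (rule Lim_transform_eventually[rotated])
    then show "g ((h + k) # hs) = g (h # hs) + g (k # hs)"
      using tendsto_unique[OF Suc.prems(1) lim] hs hk Rn_add by blast
  next
    fix h and r :: real assume h: "h \<in> Rn d"
    have "\<forall>\<^sub>F t in F. r *\<^sub>R f t (h # hs) = f t ((r *\<^sub>R h) # hs)"
      using Suc.prems(2) by eventually_elim (use hs h in \<open>auto simp: linear_on_Rn_def\<close>)
    moreover have "((\<lambda>t. r *\<^sub>R f t (h # hs)) \<longlongrightarrow> r *\<^sub>R g (h # hs)) F"
      by (intro tendsto_scaleR tendsto_const lim hs h)
    ultimately have "((\<lambda>t. f t ((r *\<^sub>R h) # hs)) \<longlongrightarrow> r *\<^sub>R g (h # hs)) F"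
      by (rule Lim_transform_eventually[rotated])
    then show "g ((r *\<^sub>R h) # hs) = r *\<^sub>R g (h # hs)"
      using tendsto_unique[OF Suc.prems(1) lim] hs h Rn_scaleR by blast
  qed
  moreover have "multilinear_on_Rn d q (\<lambda>hs. g (h # hs))" if h: "h \<in> Rn d" for h
  proof (rule Suc.IH[OF Suc.prems(1)])
    show "\<forall>\<^sub>F t in F. multilinear_on_Rn d q (\<lambda>hs. f t (h # hs))"
      using Suc.prems(2) by eventually_elim (use h in auto)
    show "((\<lambda>t. f t (h # hs)) \<longlongrightarrow> g (h # hs)) F" if "hs \<in> directions d q" for hs
      using lim h that by blast
  qed
  ultimately show ?case by simp
qed simp

lemma multilinear_on_Rn_diff:
  "multilinear_on_Rn d q f \<Longrightarrow> multilinear_on_Rn d q g \<Longrightarrow> multilinear_on_Rn d q (\<lambda>hs. f hs - g hs)"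
  by (induction q arbitrary: f g) (auto simp: linear_on_Rn_def algebra_simps)

lemma multilinear_on_Rn_scaleR:
  "multilinear_on_Rn d q f \<Longrightarrow> multilinear_on_Rn d q (\<lambda>hs. (r::real) *\<^sub>R f hs)"
  by (induction q arbitrary: f) (auto simp: linear_on_Rn_def algebra_simps)

lemma multilinear_on_Rn_homogeneous:
  assumes "multilinear_on_Rn d q f" "h \<in> Rn d"
  shows "f (replicate q (r *\<^sub>R h)) = r ^ q *\<^sub>R f (replicate q h)"
  using assms
proof (induction q arbitrary: f)
  case (Suc q)
  have "replicate q (r *\<^sub>R h) \<in> directions d q"
    using Suc.prems(2) by (auto simp: directions_def Rn_scaleR)
  then have "f (r *\<^sub>R h # replicate q (r *\<^sub>R h)) = r *\<^sub>R f (h # replicate q (r *\<^sub>R h))"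
    using Suc.prems unfolding multilinear_on_Rn.simps linear_on_Rn_def by blast
  also have "f (h # replicate q (r *\<^sub>R h)) = r ^ q *\<^sub>R f (h # replicate q h)"
    using Suc.IH[of "\<lambda>hs. f (h # hs)"] Suc.prems by auto
  finally show ?case by simp
qed simp

text \<open>
  Expanding one argument after another in the unit vectors leaves finitely many values. The bound makes
  the supremum in \<open>tensor_norm\<close> a genuine one.
\<close>

lemma multilinear_on_Rn_bounded:
  assumes "multilinear_on_Rn d q f"
  shows "\<exists>C. \<forall>hs\<in>directions d q. (\<forall>h\<in>set hs. norm h \<le> 1) \<longrightarrow> norm (f hs) \<le> C"
  using assms
proof (induction q arbitrary: f)
  case 0
  then show ?case by (auto simp: directions_def)
next
  case (Suc q)
  have "\<forall>i\<in>{..<d}. \<exists>C. \<forall>hs\<in>directions d q. (\<forall>h\<in>set hs. norm h \<le> 1) \<longrightarrow>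
      norm (f (unit_vector i # hs)) \<le> C"
    using Suc.IH Suc.prems unit_vector_in_Rn by auto
  then obtain C where C: "norm (f (unit_vector i # hs)) \<le> C i"
    if "i < d" "hs \<in> directions d q" "\<forall>h\<in>set hs. norm h \<le> 1" for i hs
    using bchoice[of "{..<d}"] by (metis lessThan_iff)
  have "norm (f hs) \<le> (\<Sum>i<d. C i)"
    if unit: "hs \<in> directions d (Suc q)" "\<forall>h\<in>set hs. norm h \<le> 1" for hs
  proof -
    obtain h ks where hs: "hs = h # ks"
      using unit by (cases hs) (auto simp: directions_def)
    have hs: "hs = h # ks" "h \<in> Rn d" "ks \<in> directions d q" "norm h \<le> 1"
        "\<forall>h\<in>set ks. norm h \<le> 1"
      using unit hs by simp_all
    have "f (h # ks) = (\<Sum>i<d. coord h i *\<^sub>R f (unit_vector i # ks))"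
      using linear_on_Rn_sum[of d "\<lambda>h. f (h # ks)" "{..<d}" unit_vector "coord h"] Suc.prems
        hs(2,3) unit_vector_in_Rn by (simp add: Rn_basis_expansion[symmetric])
    also have "norm \<dots> \<le> (\<Sum>i<d. C i)"
    proof (rule sum_norm_le)
      fix i assume "i \<in> {..<d}"
      then have "norm (f (unit_vector i # ks)) \<le> C i" using C hs(3,5) by auto
      moreover have "\<bar>coord h i\<bar> \<le> 1" using coord_le_norm[of h i] hs by linarith
      ultimately show "norm (coord h i *\<^sub>R f (unit_vector i # ks)) \<le> C i"
        using mult_mono[of "\<bar>coord h i\<bar>" 1 "norm (f (unit_vector i # ks))" "C i"]
        by auto
    qed
    finally show ?thesis using hs by simp
  qed
  then show ?case by blast
qed

lemma norm_le_tensor_norm: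
  assumes "multilinear_on_Rn d q f" "h \<in> Rn d"
  shows "norm (f (replicate q h)) \<le> tensor_norm d q f * norm h ^ q"
proof -
  obtain u where u: "u \<in> Rn d" "norm u \<le> 1" "h = norm h *\<^sub>R u"
  proof (cases "h = 0")
    case True
    then show ?thesis using that[of 0] Rn_zero by auto
  next
    case False
    then show ?thesis using that[of "(1 / norm h) *\<^sub>R h"] assms(2) Rn_scaleR by auto
  qed
  obtain C where C: "\<And>hs. hs \<in> directions d q \<Longrightarrow> \<forall>h\<in>set hs. norm h \<le> 1 \<Longrightarrow> norm (f hs) \<le> C"
    using multilinear_on_Rn_bounded[OF assms(1)] by blast
  have "norm (f (replicate q u)) \<le> tensor_norm d q f"
    unfolding tensor_norm_def
    by (rule cSUP_upper) (use u C in \<open>auto simp: directions_def bdd_above_def\<close>)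
  then have "norm h ^ q * norm (f (replicate q u)) \<le> norm h ^ q * tensor_norm d q f"
    by (intro mult_left_mono) auto
  moreover have "norm (f (replicate q h)) = norm h ^ q * norm (f (replicate q u))"
    by (subst u(3)) (simp add: multilinear_on_Rn_homogeneous[OF assms(1) u(1)])
  ultimately show ?thesis by (simp add: mult.commute)
qed

lemma derivatives_on_step:
  assumes "derivatives_on d U p F DF" "Suc q < p" "x \<in> U" "hs \<in> directions d q"
  shows "\<exists>A. ((\<lambda>y. DF q y hs) has_derivative A) (at x within Rn d) \<and>
    (\<forall>h\<in>Rn d. A h = DF (Suc q) x (h # hs))"
  using assms unfolding derivatives_on_def by simp

text \<open>
  Differentiability within \<open>Rn d\<close> yields a two-sided derivative along every line of \<open>Rn d\<close>, also at the end
  points of a segment in \<open>X\<close>.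
\<close>

lemma derivatives_on_line:
  assumes "derivatives_on d U p F DF" "Suc q < p" "x \<in> Rn d" "h \<in> Rn d" "hs \<in> directions d q"
    and "x + t *\<^sub>R h \<in> U"
  shows "((\<lambda>s. DF q (x + s *\<^sub>R h) hs) has_vector_derivative DF (Suc q) (x + t *\<^sub>R h) (h # hs)) (at t)"
proof -
  obtain A where A: "((\<lambda>y. DF q y hs) has_derivative A) (at (x + t *\<^sub>R h) within Rn d)"
      "\<forall>k\<in>Rn d. A k = DF (Suc q) (x + t *\<^sub>R h) (k # hs)"
    using derivatives_on_step[OF assms(1,2,6,5)] by blast
  have lin: "((\<lambda>s. x + s *\<^sub>R h) has_derivative (\<lambda>s. s *\<^sub>R h)) (at t)"
    by (auto intro!: derivative_eq_intros)
  have "((\<lambda>y. DF q y hs) has_derivative A) (at (x + t *\<^sub>R h) within range (\<lambda>s. x + s *\<^sub>R h))"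
    by (rule has_derivative_subset[OF A(1)]) (use assms in \<open>auto simp: Rn_closed\<close>)
  from diff_chain_within[OF lin this]
  have "((\<lambda>s. DF q (x + s *\<^sub>R h) hs) has_derivative (\<lambda>s. A (s *\<^sub>R h))) (at t)"
    by (simp add: o_def)
  moreover have "A (s *\<^sub>R h) = s *\<^sub>R DF (Suc q) (x + t *\<^sub>R h) (h # hs)" for s
    using linear_scale[OF has_derivative_linear[OF A(1)]] A(2) assms(4) by simp
  ultimately show ?thesis
    by (simp add: has_vector_derivative_def)
qed

text \<open>
  The first argument is the direction of a Frechet derivative. Linearity in the others is inherited from
  the derivative of one order less at nearby points of \<open>U\<close>.
\<close>

lemma derivatives_multilinear:
  assumes D: "derivatives_on d U p F DF" and U: "openin (top_of_set (Rn d)) U"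
    and "q < p" "x \<in> U"
  shows "multilinear_on_Rn d q (DF q x)"
  using assms(3,4)
proof (induction q arbitrary: x)
  case (Suc q)
  have xR: "x \<in> Rn d" using U Suc.prems openin_imp_subset by blast
  have "linear_on_Rn d (\<lambda>h. DF (Suc q) x (h # hs))" if hs: "hs \<in> directions d q" for hs
  proof -
    obtain A where A: "((\<lambda>y. DF q y hs) has_derivative A) (at x within Rn d)"
        "\<forall>h\<in>Rn d. A h = DF (Suc q) x (h # hs)"
      using derivatives_on_step[OF D Suc.prems hs] by blast
    have eq: "DF (Suc q) x (h # hs) = A h" if "h \<in> Rn d" for h
      using A(2) that by simp
    show ?thesis
      using has_derivative_linear[OF A(1)] unfolding linear_on_Rn_def
      by (simp add: eq Rn_add Rn_scaleR linear_add linear_scale)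
  qed
  moreover have "multilinear_on_Rn d q (\<lambda>hs. DF (Suc q) x (h # hs))" if h: "h \<in> Rn d" for h
  proof (rule multilinear_on_Rn_limit[where F = "at (0::real)"])
    show "((\<lambda>t. (1 / t) *\<^sub>R (DF q (x + t *\<^sub>R h) hs - DF q x hs)) \<longlongrightarrow> DF (Suc q) x (h # hs)) (at 0)"
      if "hs \<in> directions d q" for hs
    proof -
      have "((\<lambda>s. DF q (x + s *\<^sub>R h) hs) has_derivative (\<lambda>s. s *\<^sub>R DF (Suc q) x (h # hs))) (at 0)"
        using derivatives_on_line[OF D Suc.prems(1) xR h that, of 0] Suc.prems(2)
        unfolding has_vector_derivative_def by simp
      then have "(\<lambda>t. norm (DF q (x + (0 + t) *\<^sub>R h) hs - DF q (x + 0 *\<^sub>R h) hs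
          - t *\<^sub>R DF (Suc q) x (h # hs)) / norm t) \<midarrow>0\<rightarrow> 0"
        unfolding has_derivative_at by blast
      then have "(\<lambda>t. norm (DF q (x + t *\<^sub>R h) hs - DF q x hs - t *\<^sub>R DF (Suc q) x (h # hs)) / norm t)
          \<midarrow>0\<rightarrow> 0"
        by simp
      then have "(\<lambda>t. norm ((1 / t) *\<^sub>R (DF q (x + t *\<^sub>R h) hs - DF q x hs)
          - DF (Suc q) x (h # hs))) \<midarrow>0\<rightarrow> 0"
      proof (rule Lim_transform_eventually)
        have "norm (DF q (x + t *\<^sub>R h) hs - DF q x hs - t *\<^sub>R DF (Suc q) x (h # hs)) / norm t
          = norm ((1 / t) *\<^sub>R (DF q (x + t *\<^sub>R h) hs - DF q x hs) - DF (Suc q) x (h # hs))"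
          if "t \<noteq> 0" for t
        proof -
        have "DF q (x + t *\<^sub>R h) hs - DF q x hs - t *\<^sub>R DF (Suc q) x (h # hs)
            = t *\<^sub>R ((1 / t) *\<^sub>R (DF q (x + t *\<^sub>R h) hs - DF q x hs) - DF (Suc q) x (h # hs))"
            using that by (simp add: scaleR_right_diff_distrib)
          then show ?thesis using that by (simp only: norm_scaleR) simp
        qed
        then show "\<forall>\<^sub>F t in at 0. norm (DF q (x + t *\<^sub>R h) hs - DF q x hs
            - t *\<^sub>R DF (Suc q) x (h # hs)) / norm t
          = norm ((1 / t) *\<^sub>R (DF q (x + t *\<^sub>R h) hs - DF q x hs) - DF (Suc q) x (h # hs))"
          by (auto simp: eventually_at_filter)
      qed
      then show ?thesis
        by (simp add: LIM_zero_iff tendsto_norm_zero_iff)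
    qed
    obtain T where T: "open T" "U = Rn d \<inter> T"
      using U by (auto simp: openin_open)
    have "((\<lambda>t. x + t *\<^sub>R h) \<longlongrightarrow> x + 0 *\<^sub>R h) (at 0)"
      by (intro tendsto_intros)
    then have "\<forall>\<^sub>F t in at 0. x + t *\<^sub>R h \<in> T"
      using T Suc.prems(2) by (intro topological_tendstoD) auto
    then show "\<forall>\<^sub>F t in at (0::real).
        multilinear_on_Rn d q (\<lambda>hs. (1 / t) *\<^sub>R (DF q (x + t *\<^sub>R h) hs - DF q x hs))"
    proof eventually_elim
      case (elim t)
      then have "x + t *\<^sub>R h \<in> U" using T xR h by (auto simp: Rn_closed)
      then show ?case
        using Suc by (intro multilinear_on_Rn_scaleR multilinear_on_Rn_diff) auto
    qed
  qed simp
  ultimately show ?case by simp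
qed simp

section \<open>Taylor expansion\<close>

text \<open>
  The argument \<open>J\<close> is the jet returned by the oracle at \<open>y\<close>.
\<close>

definition taylor_model :: "nat \<Rightarrow> answer \<Rightarrow> fvec \<Rightarrow> fvec \<Rightarrow> fvec"
  where "taylor_model p J y x = (\<Sum>q<p. (1 / fact q) *\<^sub>R (J ! q) (replicate q (x - y)))"

text \<open>
  The Lagrange form of the remainder, applied along the segment from \<open>y\<close> to \<open>x\<close> to the component of \<open>F\<close> in
  the direction of the error, stops at order \<open>p - 1\<close>; the difference of two values of the derivative of that
  order is controlled by the Lipschitz condition. The factor \<open>1 / (p - 1)!\<close> is dropped.
\<close>

lemma taylor_remainder:
  assumes "p \<ge> 1" "X \<subseteq> Rn d" "convex X" "smooth_operator_on d X p L F DF" "x \<in> X" "y \<in> X"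
  shows "norm (F x - taylor_model p (jet_oracle p DF y) y x) \<le> L * norm (x - y) ^ p"
proof -
  obtain U where U: "openin (top_of_set (Rn d)) U" "X \<subseteq> U" and D: "derivatives_on d U p F DF"
    using assms(4) unfolding smooth_operator_on_def by blast
  have lip: "tensor_norm d (p - 1) (\<lambda>hs. DF (p - 1) u hs - DF (p - 1) v hs) \<le> L * norm (u - v)"
    if "u \<in> X" "v \<in> X" for u v
    using assms(4) that unfolding smooth_operator_on_def by blast
  define h where "h = x - y"
  have h: "h \<in> Rn d" using assms h_def Rn_diff by blast
  have seg: "y + t *\<^sub>R h \<in> X" if "0 \<le> t" "t \<le> 1" for t
    using convexD_alt[OF assms(3,6,5) that] by (simp add: h_def algebra_simps)
  have top: "norm (DF (p - 1) (y + t *\<^sub>R h) (replicate (p - 1) h) - DF (p - 1) y (replicate (p - 1) h))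
      \<le> L * norm h ^ p" if t: "0 \<le> t" "t \<le> 1" for t
  proof -
    have L0: "0 \<le> L * norm h"
    proof -
      have "0 \<le> tensor_norm d (p - 1) (\<lambda>hs. DF (p - 1) x hs - DF (p - 1) y hs)"
        unfolding tensor_norm_def
      proof (rule cSUP_upper2)
        show "replicate (p - 1) 0 \<in> {hs \<in> directions d (p - 1). \<forall>h\<in>set hs. norm h \<le> 1}"
          by (auto simp: directions_def Rn_zero)
        have "multilinear_on_Rn d (p - 1) (\<lambda>hs. DF (p - 1) x hs - DF (p - 1) y hs)"
          using derivatives_multilinear[OF D U(1), of "p - 1"] assms U
          by (intro multilinear_on_Rn_diff) auto
        from multilinear_on_Rn_bounded[OF this]
        show "bdd_above ((\<lambda>hs. norm (DF (p - 1) x hs - DF (p - 1) y hs)) `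
            {hs \<in> directions d (p - 1). \<forall>h\<in>set hs. norm h \<le> 1})"
          by (auto simp: bdd_above_def)
      qed simp
      then show ?thesis using lip[OF assms(5,6)] by (simp add: h_def)
    qed
    have "multilinear_on_Rn d (p - 1) (\<lambda>hs. DF (p - 1) (y + t *\<^sub>R h) hs - DF (p - 1) y hs)"
      using derivatives_multilinear[OF D U(1), of "p - 1"] assms U seg[OF t]
      by (intro multilinear_on_Rn_diff) auto
    from norm_le_tensor_norm[OF this h]
    have "norm (DF (p - 1) (y + t *\<^sub>R h) (replicate (p - 1) h) - DF (p - 1) y (replicate (p - 1) h))
       \<le> tensor_norm d (p - 1) (\<lambda>hs. DF (p - 1) (y + t *\<^sub>R h) hs - DF (p - 1) y hs) * norm h ^ (p - 1)" .
    also have "\<dots> \<le> (L * norm (y + t *\<^sub>R h - y)) * norm h ^ (p - 1)"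
      using lip[OF seg[OF t] assms(6)] by (intro mult_right_mono) auto
    also have "\<dots> = t * (L * norm h) * norm h ^ (p - 1)"
      using t by simp
    also have "\<dots> \<le> (L * norm h) * norm h ^ (p - 1)"
      using t L0 by (intro mult_right_mono mult_left_le_one_le) auto
    also have "\<dots> = L * norm h ^ p" using assms(1) by (cases p) auto
    finally show ?thesis .
  qed
  \<comment> \<open>Testing the error with itself reduces the vector-valued expansion to a scalar one.\<close>
  define v where "v = F x - taylor_model p (jet_oracle p DF y) y x"
  have "inner v v \<le> norm v * (L * norm h ^ p)"
  proof -
    define diff where "diff q t = inner (DF q (y + t *\<^sub>R h) (replicate q h)) v" for q t
    obtain t where t: "0 \<le> t" "t \<le> 1" and
      ft: "inner (F x) v = (\<Sum>q<p - 1. diff q 0 / fact q) + diff (p - 1) t / fact (p - 1)"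
    proof (cases "p = 1")
      case True
      have "inner (F x) v = diff 0 1"
        using D assms(2,5) unfolding diff_def derivatives_on_def h_def by auto
      then show ?thesis using that[of 1] True by simp
    next
      case False
      have "DERIV (diff q) t :> diff (Suc q) t" if "q < p - 1" "0 \<le> t" "t \<le> 1" for q t
      proof -
        have "((\<lambda>s. DF q (y + s *\<^sub>R h) (replicate q h)) has_vector_derivative
            DF (Suc q) (y + t *\<^sub>R h) (h # replicate q h)) (at t)"
          by (rule derivatives_on_line[OF D])
             (use that assms seg U h in \<open>auto simp: directions_def\<close>)
        then have "((\<lambda>s. inner (DF q (y + s *\<^sub>R h) (replicate q h)) v) has_vector_derivative
            inner (DF (Suc q) (y + t *\<^sub>R h) (h # replicate q h)) v) (at t)"
          by (rule bounded_linear.has_vector_derivative[OF bounded_linear_inner_left])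
        then show ?thesis
          by (simp add: diff_def[abs_def] has_real_derivative_iff_has_vector_derivative)
      qed
      with Maclaurin[of 1 "p - 1" diff "diff 0"] False assms(1)
      obtain t where "0 < t" "t < 1"
        "diff 0 1 = (\<Sum>q<p - 1. diff q 0 / fact q * 1 ^ q) + diff (p - 1) t / fact (p - 1) * 1 ^ (p - 1)"
        by auto
      moreover have "inner (F x) v = diff 0 1"
        using D assms(2,5) unfolding diff_def derivatives_on_def h_def by auto
      ultimately show ?thesis using that[of t] by simp
    qed
    have "inner (taylor_model p (jet_oracle p DF y) y x) v = (\<Sum>q<p. diff q 0 / fact q)"
      unfolding taylor_model_def inner_sum_left
      by (rule sum.cong) (auto simp: diff_def jet_oracle_def h_def)
    also have "\<dots> = (\<Sum>q<p - 1. diff q 0 / fact q) + diff (p - 1) 0 / fact (p - 1)"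
      using assms(1) by (cases p) auto
    finally have "inner v v = (diff (p - 1) t - diff (p - 1) 0) / fact (p - 1)"
      using ft by (simp add: v_def inner_diff_left diff_divide_distrib)
    also have "\<dots> \<le> \<bar>diff (p - 1) t - diff (p - 1) 0\<bar>"
    proof -
      have "(diff (p - 1) t - diff (p - 1) 0) / fact (p - 1) \<le> \<bar>diff (p - 1) t - diff (p - 1) 0\<bar> / fact (p - 1)"
        by (intro divide_right_mono) auto
      also have "\<dots> \<le> \<bar>diff (p - 1) t - diff (p - 1) 0\<bar> / 1"
        by (intro divide_left_mono) (auto simp: fact_ge_1)
      finally show ?thesis by simp
    qed
    also have "\<dots> = \<bar>inner (DF (p - 1) (y + t *\<^sub>R h) (replicate (p - 1) h)
        - DF (p - 1) y (replicate (p - 1) h)) v\<bar>"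
      by (simp add: diff_def inner_diff_left)
    also have "\<dots> \<le> norm (DF (p - 1) (y + t *\<^sub>R h) (replicate (p - 1) h)
        - DF (p - 1) y (replicate (p - 1) h)) * norm v"
      by (rule Cauchy_Schwarz_ineq2)
    also have "\<dots> \<le> (L * norm h ^ p) * norm v"
      using top[OF t] by (intro mult_right_mono) auto
    finally show ?thesis by (simp add: mult.commute)
  qed
  then have "norm v * norm v \<le> norm v * (L * norm h ^ p)"
    by (simp add: power2_norm_eq_inner[symmetric] power2_eq_square)
  moreover have "0 \<le> L * norm h ^ p"
    using top[of 0] norm_ge_zero order_trans by fastforce
  ultimately have "norm v \<le> L * norm h ^ p"
    by (cases "norm v = 0") (auto simp: mult_le_cancel_left)
  then show ?thesis by (simp add: v_def h_def)
qed

text \<open>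
  For \<open>p \<ge> 2\<close> the first derivative is continuous, hence bounded on the compact set \<open>X\<close>. The constant \<open>M\<close> is
  not controlled by \<open>L\<close>; it serves to show that proximal steps exist.
\<close>

lemma smooth_operator_lipschitz:
  assumes "p \<ge> 2" "X \<subseteq> Rn d" "convex X" "compact X" "smooth_operator_on d X p L F DF"
  shows "\<exists>M\<ge>0. \<forall>x\<in>X. \<forall>y\<in>X. norm (F x - F y) \<le> M * norm (x - y)"
proof -
  obtain U where U: "openin (top_of_set (Rn d)) U" "X \<subseteq> U" and D: "derivatives_on d U p F DF"
    using assms(5) unfolding smooth_operator_on_def by blast
  have "\<exists>C. \<forall>z\<in>X. norm (DF 1 z [unit_vector i]) \<le> C" if "i < d" for i
  proof -
    have "continuous_on X (\<lambda>z. DF 1 z [unit_vector i])"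
      using D U(2) assms(1) that unit_vector_in_Rn unfolding derivatives_on_def
      by (intro continuous_on_subset[OF _ U(2)]) (auto simp: directions_def)
    then have "compact ((\<lambda>z. DF 1 z [unit_vector i]) ` X)"
      using assms(4) by (rule compact_continuous_image)
    then show ?thesis
      using compact_imp_bounded bounded_iff by (metis imageI)
  qed
  then obtain C where C: "\<And>i z. i < d \<Longrightarrow> z \<in> X \<Longrightarrow> norm (DF 1 z [unit_vector i]) \<le> C i"
    by metis
  define M where "M = (\<Sum>i<d. \<bar>C i\<bar>)"
  have bound: "norm (DF 1 z [h]) \<le> M * norm h" if z: "z \<in> X" and h: "h \<in> Rn d" for z h
  proof -
    have "multilinear_on_Rn d (Suc 0) (DF 1 z)"
      using derivatives_multilinear[OF D U(1), of "Suc 0" z] assms(1) U z by auto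
    moreover have "[] \<in> directions d 0" by (simp add: directions_def)
    ultimately have "linear_on_Rn d (\<lambda>h. DF 1 z [h])"
      unfolding multilinear_on_Rn.simps by blast
    from linear_on_Rn_sum[OF this, of "{..<d}" unit_vector "coord h"]
    have "DF 1 z [h] = (\<Sum>i<d. coord h i *\<^sub>R DF 1 z [unit_vector i])"
      using h unit_vector_in_Rn by (simp add: Rn_basis_expansion[symmetric])
    also have "norm \<dots> \<le> (\<Sum>i<d. \<bar>C i\<bar> * norm h)"
    proof (rule sum_norm_le)
      fix i assume "i \<in> {..<d}"
      then have "norm (DF 1 z [unit_vector i]) \<le> \<bar>C i\<bar>" using C[of i z] z by auto
      then show "norm (coord h i *\<^sub>R DF 1 z [unit_vector i]) \<le> \<bar>C i\<bar> * norm h"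
        using mult_mono[OF coord_le_norm[of h i], of "norm (DF 1 z [unit_vector i])" "\<bar>C i\<bar>"]
        by (simp add: mult.commute)
    qed
    finally show ?thesis by (simp add: M_def sum_distrib_right)
  qed
  have "norm (F x - F y) \<le> M * norm (x - y)" if xy: "x \<in> X" "y \<in> X" for x y
  proof -
    have h: "x - y \<in> Rn d" using xy assms(2) Rn_diff by blast
    have seg: "y + t *\<^sub>R (x - y) \<in> X" if "0 \<le> t" "t \<le> 1" for t
      using convexD_alt[OF assms(3) xy(2,1) that] by (simp add: algebra_simps)
    have F0: "DF 0 z [] = F z" if "z \<in> X" for z
      using D assms(2) that unfolding derivatives_on_def by auto
    have "norm (DF 0 (y + 1 *\<^sub>R (x - y)) [] - DF 0 (y + 0 *\<^sub>R (x - y)) []) \<le> M * norm (x - y) * norm (1 - 0 :: real)"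
    proof (rule differentiable_bound[where S = "{0..1}" and f = "\<lambda>s. DF 0 (y + s *\<^sub>R (x - y)) []"
          and f' = "\<lambda>t s. s *\<^sub>R DF 1 (y + t *\<^sub>R (x - y)) [x - y]"])
      fix t :: real assume t: "t \<in> {0..1}"
      show "((\<lambda>s. DF 0 (y + s *\<^sub>R (x - y)) []) has_derivative
          (\<lambda>s. s *\<^sub>R DF 1 (y + t *\<^sub>R (x - y)) [x - y])) (at t within {0..1})"
        using derivatives_on_line[OF D, of 0 y "x - y" "[]" t] assms(1,2) xy h seg[of t] t U
        by (auto simp: has_vector_derivative_def directions_def intro: has_derivative_at_withinI)
      show "onorm (\<lambda>s. s *\<^sub>R DF 1 (y + t *\<^sub>R (x - y)) [x - y]) \<le> M * norm (x - y)"
      proof (rule onorm_le)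
        fix s :: real
        have "\<bar>s\<bar> * norm (DF 1 (y + t *\<^sub>R (x - y)) [x - y]) \<le> \<bar>s\<bar> * (M * norm (x - y))"
          using bound[OF seg h] t by (intro mult_left_mono) auto
        then show "norm (s *\<^sub>R DF 1 (y + t *\<^sub>R (x - y)) [x - y]) \<le> M * norm (x - y) * norm s"
          by (simp add: mult.commute)
      qed
    qed auto
    then show ?thesis using F0 xy by simp
  qed
  moreover have "M \<ge> 0" by (simp add: M_def sum_nonneg)
  ultimately show ?thesis by blast
qed

section \<open>Resolvents of monotone operators\<close>

text \<open>
  The metric projection to \<open>X\<close>. The ambient space is infinite-dimensional, so that its existence rests on
  compactness of \<open>X\<close>.
\<close>

definition nearest_point :: "fvec set \<Rightarrow> fvec \<Rightarrow> fvec"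
  where "nearest_point X z = (SOME y. y \<in> X \<and> (\<forall>x\<in>X. dist z y \<le> dist z x))"

lemma nearest_point:
  assumes "compact X" "X \<noteq> {}"
  shows nearest_point_in: "nearest_point X z \<in> X"
    and nearest_point_le: "x \<in> X \<Longrightarrow> dist z (nearest_point X z) \<le> dist z x"
proof -
  have "\<exists>y\<in>X. \<forall>x\<in>X. dist z y \<le> dist z x"
    by (rule continuous_attains_inf[OF assms]) (intro continuous_intros)
  then have "\<exists>y. y \<in> X \<and> (\<forall>x\<in>X. dist z y \<le> dist z x)" by blast
  from someI_ex[OF this] show "nearest_point X z \<in> X"
    and "x \<in> X \<Longrightarrow> dist z (nearest_point X z) \<le> dist z x"
    unfolding nearest_point_def by blast+
qed

lemma nearest_point_dot:
  assumes "compact X" "convex X" "y \<in> X"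
  shows "inner (z - nearest_point X z) (y - nearest_point X z) \<le> 0"
proof (rule any_closest_point_dot[OF assms(2) compact_imp_closed[OF assms(1)] _ assms(3)])
  have "X \<noteq> {}" using assms(3) by blast
  then show "nearest_point X z \<in> X" "\<forall>x\<in>X. dist z (nearest_point X z) \<le> dist z x"
    using nearest_point[OF assms(1)] by blast+
qed

lemma nearest_point_nonexpansive:
  assumes "compact X" "convex X" "X \<noteq> {}"
  shows "dist (nearest_point X x) (nearest_point X y) \<le> dist x y"
proof -
  let ?P = "nearest_point X"
  have "inner (x - ?P x) (?P y - ?P x) \<le> 0" "inner (y - ?P y) (?P x - ?P y) \<le> 0"
    using nearest_point_dot nearest_point_in assms by simp_all
  then show ?thesis unfolding dist_norm and norm_le
    using inner_ge_zero[of "(x - ?P x) - (y - ?P y)"]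
    by (simp add: inner_add inner_diff inner_commute)
qed

text \<open>
  The equation is a strongly monotone Lipschitz variational inequality. Its solutions are the fixed points of
  the projected step \<open>x \<mapsto> P (x - t (x - w + lam F x))\<close>, and this map is a contraction for small \<open>t\<close>.
\<close>

lemma resolvent_exists:
  assumes X: "compact X" "convex X" "X \<noteq> {}" "X \<subseteq> Rn d"
    and F: "\<And>x. x \<in> X \<Longrightarrow> F x \<in> Rn d" "monotone_operator_on X F"
    and M: "M \<ge> 0" "\<And>x y. x \<in> X \<Longrightarrow> y \<in> X \<Longrightarrow> norm (F x - F y) \<le> M * norm (x - y)"
    and lam: "lam > 0" and w: "w \<in> Rn d"
  shows "\<exists>x\<in>X. \<exists>n\<in>normal_cone d X x. x + lam *\<^sub>R (F x + n) = w"
proof -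
  define G where "G x = x - w + lam *\<^sub>R F x" for x
  define N where "N = 1 + lam * M"
  \<comment> \<open>This step size minimises the bound \<open>1 - 2 t + t\<^sup>2 N\<^sup>2\<close> for the squared contraction factor.\<close>
  define t where "t = 1 / N\<^sup>2"
  have N: "N \<ge> 1" using lam M by (simp add: N_def)
  then have t: "0 < t" "t \<le> 1" by (auto simp: t_def field_simps)
  have lipG: "norm (G x - G y) \<le> N * norm (x - y)" if "x \<in> X" "y \<in> X" for x y
  proof -
    have "norm (G x - G y) = norm ((x - y) + lam *\<^sub>R (F x - F y))"
      by (simp add: G_def algebra_simps)
    also have "\<dots> \<le> norm (x - y) + norm (lam *\<^sub>R (F x - F y))" by (rule norm_triangle_ineq)
    also have "\<dots> \<le> norm (x - y) + lam * (M * norm (x - y))"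
      using M(2)[OF that] lam by simp
    finally show ?thesis by (simp add: N_def algebra_simps)
  qed
  have monoG: "(norm (x - y))\<^sup>2 \<le> inner (G x - G y) (x - y)" if "x \<in> X" "y \<in> X" for x y
  proof -
    have "0 \<le> lam * inner (F x - F y) (x - y)"
      using F(2) that lam unfolding monotone_operator_on_def by simp
    moreover have "G x - G y = (x - y) + lam *\<^sub>R (F x - F y)" by (simp add: G_def algebra_simps)
    ultimately show ?thesis by (simp add: inner_add_left power2_norm_eq_inner)
  qed
  define T where "T x = nearest_point X (x - t *\<^sub>R G x)" for x
  have contr: "dist (T x) (T y) \<le> sqrt (1 - t) * dist x y" if "x \<in> X" "y \<in> X" for x y
  proof -
    have "dist (T x) (T y) \<le> norm ((x - y) - t *\<^sub>R (G x - G y))"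
      unfolding T_def using nearest_point_nonexpansive[OF X(1-3), of "x - t *\<^sub>R G x" "y - t *\<^sub>R G y"]
      by (simp add: dist_norm algebra_simps)
    also have "\<dots> \<le> sqrt (1 - t) * norm (x - y)"
    proof (rule power2_le_imp_le)
      have "(norm ((x - y) - t *\<^sub>R (G x - G y)))\<^sup>2
          = (norm (x - y))\<^sup>2 - 2 * t * inner (G x - G y) (x - y) + t\<^sup>2 * (norm (G x - G y))\<^sup>2"
        unfolding power2_norm_eq_inner
        by (simp add: inner_diff_left inner_diff_right inner_commute power2_eq_square algebra_simps)
      also have "\<dots> \<le> (norm (x - y))\<^sup>2 - 2 * t * (norm (x - y))\<^sup>2 + t\<^sup>2 * (N * norm (x - y))\<^sup>2"
        using monoG[OF that] lipG[OF that] t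
        by (intro add_mono diff_mono mult_left_mono power_mono) auto
      also have "t\<^sup>2 * (N * norm (x - y))\<^sup>2 = t * (norm (x - y))\<^sup>2"
        using N by (simp add: t_def power_mult_distrib power2_eq_square)
      finally show "(norm ((x - y) - t *\<^sub>R (G x - G y)))\<^sup>2 \<le> (sqrt (1 - t) * norm (x - y))\<^sup>2"
        using t by (simp add: power_mult_distrib algebra_simps)
    qed (use t in auto)
    finally show ?thesis by (simp add: dist_norm)
  qed
  have "\<exists>!x\<in>X. T x = x"
    by (rule Banach_fix[OF compact_imp_complete[OF X(1)] X(3) _ _ _ contr])
       (use t nearest_point_in[OF X(1,3)] in \<open>auto simp: T_def\<close>)
  then obtain x where x: "x \<in> X" "T x = x" by blast
  define n where "n = (1 / lam) *\<^sub>R (w - x) - F x"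
  have "inner (x - t *\<^sub>R G x - x) (y - x) \<le> 0" if "y \<in> X" for y
    using nearest_point_dot[OF X(1,2) that, of "x - t *\<^sub>R G x"] x(2) by (simp add: T_def)
  then have G: "0 \<le> inner (G x) (y - x)" if "y \<in> X" for y
    using that t by (force simp: zero_le_mult_iff)
  have nG: "n = (- (1 / lam)) *\<^sub>R G x"
    using lam by (simp add: n_def G_def scaleR_right_diff_distrib scaleR_add_right)
  have "n \<in> normal_cone d X x"
    unfolding normal_cone_def
  proof (intro CollectI conjI ballI)
    have "x \<in> Rn d" using x X by blast
    then show "n \<in> Rn d"
      unfolding n_def by (intro Rn_diff Rn_scaleR w F(1) x)
    fix y assume "y \<in> X"
    with G lam show "inner n (y - x) \<le> 0" by (simp add: nG divide_nonneg_pos)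
  qed
  moreover have "x + lam *\<^sub>R (F x + n) = w" using lam by (simp add: n_def)
  ultimately show ?thesis using x by blast
qed

lemma VI_residual_monotone:
  assumes "monotone_operator_on X F" "x \<in> X" "y \<in> X"
    and "g \<in> VI_residual_set d X F x" "h \<in> VI_residual_set d X F y"
  shows "0 \<le> inner (g - h) (x - y)"
proof -
  obtain n m where g: "g = F x + n" "n \<in> normal_cone d X x" and h: "h = F y + m" "m \<in> normal_cone d X y"
    using assms(4,5) unfolding VI_residual_set_def by blast
  have "inner n (y - x) \<le> 0" "inner m (x - y) \<le> 0"
    using g(2) h(2) assms(2,3) unfolding normal_cone_def by blast+
  moreover have "0 \<le> inner (F x - F y) (x - y)"
    using assms unfolding monotone_operator_on_def by blast
  ultimately show ?thesis
    by (simp add: g h inner_diff_left inner_diff_right inner_add_left)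
qed

text \<open>
  Adding the identity turns monotonicity into strong monotonicity with modulus one, so that approximate
  solutions of a proximal equation are close to exact ones.
\<close>

lemma resolvent_stable:
  fixes x y g h :: "'a::real_inner"
  assumes "0 \<le> inner (g - h) (x - y)" "0 \<le> lam"
  shows "norm (x - y) \<le> norm ((x + lam *\<^sub>R g) - (y + lam *\<^sub>R h))"
proof -
  have "inner (x - y) (x - y) \<le> inner ((x + lam *\<^sub>R g) - (y + lam *\<^sub>R h)) (x - y)"
  proof -
    have eq: "(x + lam *\<^sub>R g) - (y + lam *\<^sub>R h) = (x - y) + lam *\<^sub>R (g - h)"
      by (simp add: algebra_simps)
    show ?thesis unfolding eq using assms by (simp only: inner_add_left inner_scaleR_left) simp
  qed
  also have "\<dots> \<le> norm ((x + lam *\<^sub>R g) - (y + lam *\<^sub>R h)) * norm (x - y)"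
    by (rule norm_cauchy_schwarz)
  finally have "norm (x - y) * norm (x - y) \<le> norm ((x + lam *\<^sub>R g) - (y + lam *\<^sub>R h)) * norm (x - y)"
    by (simp add: power2_norm_eq_inner[symmetric] power2_eq_square)
  then show ?thesis
    by (cases "x = y") (auto simp: mult_le_cancel_right)
qed

section \<open>Anchored proximal steps\<close>

text \<open>
  The Lyapunov function of the anchored flow \<open>dx/dA = (x0 - x) / A - g\<close>.
\<close>

definition potential :: "'a::real_inner \<Rightarrow> real \<Rightarrow> 'a \<Rightarrow> 'a \<Rightarrow> real"
  where "potential x0 A x g = A * inner g (x - x0) + A\<^sup>2 / 2 * (norm g)\<^sup>2"

text \<open>
  By monotonicity the solution \<open>xs\<close> lies in the half space \<open>\<langle>g, x - xs\<rangle> \<ge> 0\<close>, so the inner product in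
  the potential is at least \<open>- D \<parallel>g\<parallel>\<close>, which the quadratic term absorbs.
\<close>

lemma potential_lower_bound:
  assumes "0 \<le> inner g (x - xs)" "norm (x0 - xs) \<le> D" "A \<ge> 0"
  shows "(A * norm g)\<^sup>2 \<le> 4 * (potential x0 A x g + D\<^sup>2)"
proof -
  have "- inner g (xs - x0) \<le> norm g * norm (xs - x0)"
    using Cauchy_Schwarz_ineq2[of g "xs - x0"] by linarith
  also have "\<dots> \<le> norm g * D"
    using assms(2) by (intro mult_left_mono) (auto simp: norm_minus_commute)
  finally have "- (norm g * D) \<le> inner g (x - x0)"
    using assms(1) by (simp add: inner_diff_right)
  then have "A * (- (norm g * D)) \<le> A * inner g (x - x0)"
    using assms(3) by (rule mult_left_mono)
  moreover have "0 \<le> (A * norm g - 2 * D)\<^sup>2" by simp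
  ultimately show ?thesis
    by (simp add: potential_def power2_eq_square algebra_simps)
qed

text \<open>
  Monotonicity, tested with the displacement \<open>x' - x\<close> that the step prescribes, bounds \<open>\<langle>g' - g, x - x0\<rangle>\<close>
  from above. After substitution the terms of first order in \<open>a\<close> cancel; what remains is
  \<open>- A\<^sup>2 \<parallel>g' - g\<parallel>\<^sup>2 / 2\<close>, a term of order \<open>a\<^sup>2 \<parallel>g'\<parallel>\<^sup>2\<close> and the contribution of \<open>e\<close>. A quarter
  of the decrease is kept, the rest pays for \<open>e\<close> and for replacing \<open>g'\<close> by \<open>g\<close>.
\<close>

lemma anchored_step_decrease:
  fixes x x' x0 g g' e :: "'a::real_inner"
  assumes a: "0 < a" "4 * a \<le> A"
    and step: "(A + a) *\<^sub>R (x' - x0) = A *\<^sub>R (x - x0) - (a * A) *\<^sub>R (g' - e)"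
    and e: "norm e \<le> norm (g' - g) / 6"
    and mono: "0 \<le> inner (g' - g) (x' - x)"
  shows "potential x0 (A + a) x' g' + (A * norm (g' - g))\<^sup>2 / 8
    \<le> potential x0 A x g + 2 * (a * norm g)\<^sup>2"
proof -
  define u where "u = x - x0"
  define c where "c = g' - g"
  define P where "P = inner g g"
  define Q where "Q = inner c c"
  define R where "R = inner g c"
  define s where "s = inner g e"
  define t where "t = inner c e"
  have A: "A > 0" using a by linarith
  have g': "g' = g + c" by (simp add: c_def)
  have "(A + a) *\<^sub>R (x' - x) = (A + a) *\<^sub>R (x' - x0) - (A + a) *\<^sub>R u"
    by (simp add: u_def algebra_simps)
  also have "\<dots> = (- a) *\<^sub>R (u + A *\<^sub>R (g' - e))"
    unfolding step u_def by (simp add: algebra_simps)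
  finally have "(A + a) * inner c (x' - x) = - a * inner c (u + A *\<^sub>R (g' - e))"
    by (metis inner_scaleR_right)
  moreover have "0 \<le> (A + a) * inner c (x' - x)" using mono A a c_def by simp
  ultimately have "inner c (u + A *\<^sub>R (g' - e)) \<le> 0"
    using a by (simp add: mult_le_0_iff)
  then have "A * inner c u + A\<^sup>2 * (R + Q - t) \<le> 0"
    using mult_left_mono[of "inner c (u + A *\<^sub>R (g' - e))" 0 A] A
    by (simp add: g' R_def Q_def t_def inner_add_right inner_diff_right inner_commute
        power2_eq_square algebra_simps)
  moreover have "potential x0 (A + a) x' g' - potential x0 A x g
      = A * inner c u - a * A * (P + 2 * R + Q - s - t) + (A + a)\<^sup>2 / 2 * (P + 2 * R + Q) - A\<^sup>2 / 2 * P"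
  proof -
    have "(A + a) * inner g' (x' - x0) = inner g' ((A + a) *\<^sub>R (x' - x0))" by simp
    also have "\<dots> = A * inner g u + A * inner c u - a * A * (P + 2 * R + Q - s - t)"
      unfolding step
      by (simp add: g' u_def[symmetric] P_def R_def Q_def s_def t_def inner_add_left inner_add_right
          inner_diff_right inner_commute algebra_simps)
    finally show ?thesis
      by (simp add: potential_def power2_norm_eq_inner u_def[symmetric] g' P_def R_def Q_def
          inner_add_left inner_add_right inner_commute)
  qed
  ultimately have main: "potential x0 (A + a) x' g' - potential x0 A x g
      \<le> - (A\<^sup>2 * Q) / 2 + a\<^sup>2 / 2 * (P + 2 * R + Q) + A\<^sup>2 * t + a * A * (s + t)"
    by (simp add: power2_eq_square field_simps)
  have e6: "norm e \<le> norm c / 6" using e by (simp add: c_def)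
  have t: "t \<le> Q / 6"
  proof -
    have "t \<le> norm c * norm e" unfolding t_def by (rule norm_cauchy_schwarz)
    also have "\<dots> \<le> norm c * (norm c / 6)" using e6 by (intro mult_left_mono) auto
    finally show ?thesis by (simp add: Q_def power2_norm_eq_inner[symmetric] power2_eq_square)
  qed
  have s: "a * A * s \<le> (a\<^sup>2 * P + A\<^sup>2 * Q) / 12"
  proof -
    have "s \<le> norm g * norm e" unfolding s_def by (rule norm_cauchy_schwarz)
    also have "\<dots> \<le> norm g * (norm c / 6)" using e6 by (intro mult_left_mono) auto
    finally have "a * A * s \<le> a * A * (norm g * (norm c / 6))"
      using a A by (intro mult_left_mono) auto
    also have "\<dots> \<le> ((a * norm g)\<^sup>2 + (A * norm c)\<^sup>2) / 12"
      using sum_squares_bound[of "a * norm g" "A * norm c"] by (simp add: algebra_simps)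
    finally show ?thesis
      by (simp add: P_def Q_def power_mult_distrib power2_norm_eq_inner)
  qed
  have R: "2 * R \<le> P + Q"
    using inner_ge_zero[of "g - c"]
    by (simp add: P_def Q_def R_def inner_diff_left inner_diff_right inner_commute)
  have PQ: "0 \<le> P" "0 \<le> Q" by (auto simp: P_def Q_def)
  have aA: "a\<^sup>2 \<le> A\<^sup>2 / 16" "a * A \<le> A\<^sup>2 / 4"
    using a A power_mono[of "4 * a" A 2] mult_right_mono[of "4 * a" A A]
    by (auto simp: power2_eq_square)
  have "a\<^sup>2 / 2 * (P + 2 * R + Q) \<le> a\<^sup>2 / 2 * (2 * P + 2 * Q)"
    using R by (intro mult_left_mono) auto
  then have 1: "a\<^sup>2 / 2 * (P + 2 * R + Q) \<le> a\<^sup>2 * P + A\<^sup>2 * Q / 16"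
    using mult_right_mono[OF aA(1) PQ(2)] by (simp add: algebra_simps)
  have 2: "A\<^sup>2 * t \<le> A\<^sup>2 * Q / 6"
    using mult_left_mono[OF t, of "A\<^sup>2"] by simp
  have 3: "a * A * t \<le> A\<^sup>2 * Q / 24"
  proof -
    have "a * A * t \<le> a * A * (Q / 6)" using t a A by (intro mult_left_mono) auto
    also have "\<dots> \<le> A\<^sup>2 / 4 * (Q / 6)" using aA PQ by (intro mult_right_mono) auto
    finally show ?thesis by simp
  qed
  have "0 \<le> A\<^sup>2 * Q" "0 \<le> a\<^sup>2 * P" using PQ by auto
  then have "potential x0 (A + a) x' g' - potential x0 A x g \<le> - (A\<^sup>2 * Q) / 8 + 2 * (a\<^sup>2 * P)"
    using main[unfolded distrib_left[of "a * A"]] 1 2 3 s by argo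
  then show ?thesis
    by (simp add: P_def Q_def c_def power_mult_distrib power2_norm_eq_inner)
qed

text \<open>
  Adding the equations of the two halves shows that \<open>x2\<close> satisfies the equation of the full step up to an
  error \<open>z\<close> which is small when \<open>g\<close> changes little. The summand with \<open>a / A\<close> is the discretisation
  error: the weights \<open>a A\<close> of the full step and of the two halves agree to first order only. Stability of
  the resolvent transfers the closeness to the prediction from \<open>x2\<close> to the exact full step.
\<close>

lemma half_steps_predict_full_step:
  fixes x x1 x2 xh x0 g g1 g2 gh e1 e2 :: "'a::real_inner"
  assumes a: "0 < a" "4 * a \<le> A"
    and step1: "(A + a / 2) *\<^sub>R (x1 - x0) = A *\<^sub>R (x - x0) - (a / 2 * A) *\<^sub>R (g1 - e1)"
    and step2: "(A + a) *\<^sub>R (x2 - x0)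
        = (A + a / 2) *\<^sub>R (x1 - x0) - (a / 2 * (A + a / 2)) *\<^sub>R (g2 - e2)"
    and e: "norm e1 \<le> norm (g1 - g) / 6" "norm e2 \<le> norm (g2 - g1) / 6"
    and lam: "lam = a * A / (A + a)" and w: "w = x0 + (A / (A + a)) *\<^sub>R (x - x0)"
    and xh: "xh + lam *\<^sub>R gh = w"
    and mono: "0 \<le> inner (gh - g2) (xh - x2)"
  shows "norm (xh - (w - lam *\<^sub>R g))
    \<le> lam * (3 * (norm (g1 - g) + norm (g2 - g1)) + a / A * norm g)"
proof -
  define c1 where "c1 = g1 - g"
  define c2 where "c2 = g2 - g1"
  define z where "z = x2 + lam *\<^sub>R g2 - w"
  have A: "A > 0" using a by linarith
  have lam0: "lam > 0" using a A by (simp add: lam)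
  have "(A + a) *\<^sub>R z = (A + a) *\<^sub>R (x2 - x0) + (a * A) *\<^sub>R g2 - A *\<^sub>R (x - x0)"
  proof -
    have "z = (x2 - x0) + (a * A / (A + a)) *\<^sub>R g2 - (A / (A + a)) *\<^sub>R (x - x0)"
      by (simp add: z_def w lam)
    then show ?thesis using A a by (simp add: scaleR_add_right scaleR_diff_right)
  qed
  also have "\<dots> = (a / 2) *\<^sub>R (A *\<^sub>R c2 - (a / 2) *\<^sub>R g2 + A *\<^sub>R e1 + (A + a / 2) *\<^sub>R e2)"
  proof -
    have "(a * A) *\<^sub>R g2 = (a / 2 * A) *\<^sub>R g2 + (a / 2 * A) *\<^sub>R g2"
      by (simp add: scaleR_add_left[symmetric])
    then show ?thesis
      unfolding step2 step1 c2_def by (simp add: algebra_simps)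
  qed
  finally have zeq: "(A + a) *\<^sub>R z
      = (a / 2) *\<^sub>R (A *\<^sub>R c2 - (a / 2) *\<^sub>R g2 + A *\<^sub>R e1 + (A + a / 2) *\<^sub>R e2)" .
  have g2: "norm g2 \<le> norm g + norm c1 + norm c2"
  proof -
    have "g2 = g + c1 + c2" by (simp add: c1_def c2_def)
    then show ?thesis by (metis norm_triangle_ineq norm_triangle_le order_trans add_right_mono)
  qed
  have nn: "0 \<le> A * norm c1" "0 \<le> A * norm c2" using A by auto
  have ac: "a * norm c1 \<le> A * norm c1 / 4" "a * norm c2 \<le> A * norm c2 / 4"
    using mult_right_mono[OF a(2), of "norm c1"] mult_right_mono[OF a(2), of "norm c2"] by simp_all
  have "norm (A *\<^sub>R c2 - (a / 2) *\<^sub>R g2 + A *\<^sub>R e1 + (A + a / 2) *\<^sub>R e2)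
      \<le> A * norm c2 + a / 2 * norm g2 + A * norm e1 + (A + a / 2) * norm e2"
  proof -
    have "norm (A *\<^sub>R c2 - (a / 2) *\<^sub>R g2 + A *\<^sub>R e1 + (A + a / 2) *\<^sub>R e2)
      \<le> norm (A *\<^sub>R c2) + norm ((a / 2) *\<^sub>R g2) + norm (A *\<^sub>R e1) + norm ((A + a / 2) *\<^sub>R e2)"
      by (intro order_trans[OF norm_triangle_ineq] add_mono norm_triangle_ineq4 order_refl)
    then show ?thesis using a A by simp
  qed
  also have "\<dots> \<le> A * norm c2 + a / 2 * (norm g + norm c1 + norm c2) + A * (norm c1 / 6)
      + (A + a / 2) * (norm c2 / 6)"
    using g2 e a A by (intro add_mono mult_left_mono) (auto simp: c1_def c2_def)
  also have "\<dots> \<le> A * (2 * (norm c1 + norm c2)) + a / 2 * norm g"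
    using ac nn by (simp only: distrib_left distrib_right)
  finally have "(A + a) * norm z \<le> a / 2 * (A * (2 * (norm c1 + norm c2)) + a / 2 * norm g)"
    using arg_cong[OF zeq, of norm] a A by (simp add: mult_left_mono)
  then have z: "norm z \<le> lam * (norm c1 + norm c2 + a / (4 * A) * norm g)"
  proof -
    have "norm z \<le> a / 2 * (A * (2 * (norm c1 + norm c2)) + a / 2 * norm g) / (A + a)"
      using \<open>(A + a) * norm z \<le> _\<close> a A
      by (subst pos_le_divide_eq) (auto simp only: mult.commute[of "norm z"])
    also have "\<dots> = lam * (norm c1 + norm c2 + a / (4 * A) * norm g)"
    proof -
      have "a / 2 * (A * (2 * (norm c1 + norm c2)) + a / 2 * norm g)
          = a * A * (norm c1 + norm c2 + a / (4 * A) * norm g)"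
        using A by (simp add: field_simps)
      then show ?thesis unfolding lam by (simp only:) (simp only: times_divide_eq_left)
    qed
    finally show ?thesis .
  qed
  have "norm (xh - x2) \<le> norm z"
    using resolvent_stable[OF mono, of lam] lam0 xh by (simp add: z_def norm_minus_commute)
  moreover have "xh - (w - lam *\<^sub>R g) = (xh - x2) + z + (- lam) *\<^sub>R (c1 + c2)"
    by (simp add: z_def c1_def c2_def algebra_simps)
  moreover have "norm ((- lam) *\<^sub>R (c1 + c2)) \<le> lam * (norm c1 + norm c2)"
    using norm_triangle_ineq[of c1 c2] lam0 by (simp add: mult_left_mono)
  ultimately have "norm (xh - (w - lam *\<^sub>R g)) \<le> norm z + norm z + lam * (norm c1 + norm c2)"
    using norm_triangle_ineq[of "(xh - x2) + z" "(- lam) *\<^sub>R (c1 + c2)"]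
      norm_triangle_ineq[of "xh - x2" z] by (simp only:)
  also have "\<dots> \<le> lam * (3 * (norm c1 + norm c2) + a / A * norm g)"
  proof -
    have "0 \<le> lam * (a / A * norm g)" using lam0 a A by simp
    then show ?thesis using z A by (simp add: field_simps)
  qed
  finally show ?thesis by (simp add: c1_def c2_def)
qed

section \<open>The method\<close>

text \<open>
  \<open>Try A x g as\<close> stands for the point \<open>x\<close> with residual \<open>g\<close> at anchor weight \<open>A\<close> and the list \<open>as\<close> of step
  sizes still to be made. In \<open>Evaluate A x n as\<close> the point \<open>x\<close> and the normal vector \<open>n\<close> have been chosen,
  but the value \<open>F x\<close> that completes the residual has not yet been asked for.
\<close>

datatype state = Start | Try real fvec fvec "real list" | Evaluate real fvec fvec "real list"

locale anchored_method =
  fixes d p :: nat and L D :: real and X :: "fvec set" and x0 :: fvec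
begin

text \<open>
  The trust radius solves \<open>L * a * 2 ^ p * r ^ (p - 1) = 1 / 16\<close>; for such \<open>r\<close> the Taylor remainder at
  distance \<open>2 * r\<close>, multiplied by the step size, is \<open>r / 16\<close>.
\<close>

definition radius :: "real \<Rightarrow> real"
  where "radius a = (1 / (16 * 2 ^ p * L * a)) powr (1 / (real p - 1))"

text \<open>
  Dividing the anchored step by \<open>A + a\<close> gives the proximal equation \<open>x' + \<lambda> g' = w\<close> with weight \<open>\<lambda>\<close> and
  center \<open>w\<close> as follows.
\<close>

definition prox_weight :: "real \<Rightarrow> real \<Rightarrow> real"
  where "prox_weight A a = a * A / (A + a)"

definition prox_center :: "real \<Rightarrow> real \<Rightarrow> fvec \<Rightarrow> fvec"
  where "prox_center A a x = x0 + (A / (A + a)) *\<^sub>R (x - x0)"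

definition prediction :: "real \<Rightarrow> real \<Rightarrow> fvec \<Rightarrow> fvec \<Rightarrow> fvec"
  where "prediction A a x g = prox_center A a x - prox_weight A a *\<^sub>R g"

text \<open>
  The prediction may lie outside \<open>X\<close>, where the Taylor remainder is not controlled. It is therefore
  projected, which at most doubles the distance to a point of \<open>X\<close>.
\<close>

definition query_point :: "real \<Rightarrow> real \<Rightarrow> fvec \<Rightarrow> fvec \<Rightarrow> fvec"
  where "query_point A a x g = nearest_point X (prediction A a x g)"

text \<open>
  The Taylor model need not be monotone, so the model equation may have no solution or several. Any approximate
  solution within the trust radius will do; the tolerance relative to the distance from the prediction is
  what keeps the error of the step below a fraction of the change of the residual.
\<close>

definition candidates :: "real \<Rightarrow> real \<Rightarrow> fvec \<Rightarrow> fvec \<Rightarrow> answer \<Rightarrow> (fvec \<times> fvec) set"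
  where "candidates A a x g J = {(x', n). x' \<in> X \<and> n \<in> normal_cone d X x' \<and>
    norm (x' - prediction A a x g) \<le> radius a \<and>
    norm (x' + prox_weight A a *\<^sub>R (taylor_model p J (query_point A a x g) x' + n) - prox_center A a x)
      \<le> norm (x' - prediction A a x g) / 16}"

text \<open>
  The first proximal step starts at the anchor, where no residual is known yet, and is therefore
  centred at \<open>x0\<close> itself.
\<close>

definition start_candidates :: "real \<Rightarrow> answer \<Rightarrow> (fvec \<times> fvec) set"
  where "start_candidates A J = {(x', n). x' \<in> X \<and> n \<in> normal_cone d X x' \<and>
    norm (x' - x0) \<le> D \<and> norm (x' + A *\<^sub>R (taylor_model p J x0 x' + n) - x0) \<le> D}"

definition pick :: "(fvec \<times> fvec) set \<Rightarrow> fvec \<times> fvec"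
  where "pick S = (SOME c. c \<in> S)"

fun next_state :: "real \<Rightarrow> real list \<Rightarrow> state \<Rightarrow> answer \<Rightarrow> state"
  where
    "next_state A0 sched Start J =
       (let (x', n) = pick (start_candidates A0 J) in Evaluate A0 x' n sched)"
  | "next_state A0 sched (Evaluate A x n as) J = Try A x ((J ! 0) [] + n) as"
  | "next_state A0 sched (Try A x g []) J = Try A x g []"
  | "next_state A0 sched (Try A x g (a # as)) J =
       (if candidates A a x g J = {} then Try A x g (a / 2 # a / 2 # as)
        else let (x', n) = pick (candidates A a x g J) in Evaluate (A + a) x' n as)"

fun action_of :: "state \<Rightarrow> action"
  where
    "action_of Start = Query x0"
  | "action_of (Evaluate A x n as) = Query x"
  | "action_of (Try A x g []) = Return x"
  | "action_of (Try A x g (a # as)) = Query (query_point A a x g)"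

definition strategy :: "real \<Rightarrow> real list \<Rightarrow> strategy"
  where "strategy A0 sched answers = action_of (foldl (next_state A0 sched) Start answers)"

text \<open>
  Unlike \<open>returns\<close>, this relation may end in any state, so that runs can be concatenated.
\<close>

inductive runs :: "(fvec \<Rightarrow> answer) \<Rightarrow> real \<Rightarrow> real list \<Rightarrow> state \<Rightarrow> nat \<Rightarrow> state \<Rightarrow> bool"
  for orc A0 sched
  where
    runs_refl: "runs orc A0 sched s 0 s"
  | runs_query: "action_of s = Query z \<Longrightarrow> z \<in> Rn d \<Longrightarrow>
      runs orc A0 sched (next_state A0 sched s (orc z)) N s' \<Longrightarrow> runs orc A0 sched s (Suc N) s'"

lemma runs_trans:
  "runs orc A0 sched s M s' \<Longrightarrow> runs orc A0 sched s' N s'' \<Longrightarrow> runs orc A0 sched s (M + N) s''"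
  by (induction rule: runs.induct) (auto intro: runs.intros)

lemma runs_imp_returns:
  assumes "runs orc A0 sched s T s'" "s = foldl (next_state A0 sched) Start as"
    and "action_of s' = Return x"
  shows "returns (Rn d) orc (strategy A0 sched) as T x"
  using assms
proof (induction arbitrary: as rule: runs.induct)
  case (runs_refl s)
  then show ?case by (intro returns.stop) (simp add: strategy_def)
next
  case (runs_query s z N s')
  then show ?case
    by (intro returns.call[of _ _ z]) (auto simp: strategy_def)
qed

end

section \<open>Acceptance and rejection of a step\<close>

locale anchored_method_analysis = anchored_method +
  fixes F :: "fvec \<Rightarrow> fvec" and DF :: "nat \<Rightarrow> fvec \<Rightarrow> tensor" and xs :: fvec
  assumes p: "p \<ge> 2" and L: "L > 0" and D: "D = norm (x0 - xs)" "D > 0"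
    and X: "X \<subseteq> Rn d" "compact X" "convex X" and x0: "x0 \<in> X" and xs: "xs \<in> X"
    and F: "F ` Rn d \<subseteq> Rn d" "monotone_operator_on X F" "smooth_operator_on d X p L F DF"
    and solution: "0 \<in> VI_residual_set d X F xs"
begin

abbreviation residuals :: "fvec \<Rightarrow> fvec set"
  where "residuals \<equiv> VI_residual_set d X F"

abbreviation jet :: "fvec \<Rightarrow> answer"
  where "jet \<equiv> jet_oracle p DF"

lemma X_nonempty: "X \<noteq> {}"
  using x0 by blast

lemma jet_value: "x \<in> X \<Longrightarrow> (jet x ! 0) [] = F x"
  using F(3) p X unfolding smooth_operator_on_def derivatives_on_def jet_oracle_def by auto

lemma residual_intro: "n \<in> normal_cone d X x \<Longrightarrow> F x + n \<in> residuals x"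
  unfolding VI_residual_set_def by blast

lemma residual_monotone:
  "x \<in> X \<Longrightarrow> y \<in> X \<Longrightarrow> g \<in> residuals x \<Longrightarrow> h \<in> residuals y \<Longrightarrow> 0 \<le> inner (g - h) (x - y)"
  using VI_residual_monotone[OF F(2)] .

lemma residual_obtuse: "x \<in> X \<Longrightarrow> g \<in> residuals x \<Longrightarrow> 0 \<le> inner g (x - xs)"
  using residual_monotone[OF _ xs _ solution, of x g] by simp

lemma exact_step_exists:
  assumes "lam > 0" "w \<in> Rn d"
  shows "\<exists>x\<in>X. \<exists>n\<in>normal_cone d X x. x + lam *\<^sub>R (F x + n) = w"
proof -
  obtain M where "M \<ge> 0" "\<And>x y. x \<in> X \<Longrightarrow> y \<in> X \<Longrightarrow> norm (F x - F y) \<le> M * norm (x - y)"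
    using smooth_operator_lipschitz[OF p X(1,3,2) F(3)] by blast
  then show ?thesis
    using resolvent_exists[OF X(2,3) X_nonempty X(1) _ F(2) _ _ assms, of M] F(1) X(1) by blast
qed

lemma radius_pos: "a > 0 \<Longrightarrow> radius a > 0"
  using L by (simp add: radius_def)

lemma radius_power: 
  assumes "a > 0"
  shows "radius a ^ (p - 1) = 1 / (16 * 2 ^ p * L * a)"
proof -
  have "radius a ^ (p - 1) = radius a powr real (p - 1)"
    using radius_pos[OF assms] by (simp add: powr_realpow)
  also have "\<dots> = 1 / (16 * 2 ^ p * L * a)"
    using p L assms by (simp add: radius_def powr_powr of_nat_diff)
  finally show ?thesis .
qed

lemma radius_antimono: 
  assumes "0 < a" "a \<le> b"
  shows "radius b \<le> radius a"
  unfolding radius_def using assms L p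
  by (intro powr_mono2 divide_left_mono mult_left_mono) auto

lemma prox_weight_bounds: 
  assumes "0 < a" "0 < A"
  shows "0 < prox_weight A a" "prox_weight A a \<le> a"
  using assms by (auto simp: prox_weight_def field_simps)

lemma query_point_in: "query_point A a x g \<in> X"
  unfolding query_point_def by (rule nearest_point_in[OF X(2) X_nonempty])

text \<open>
  The projected query point is at most twice as far from \<open>x'\<close> as the prediction, so the Taylor remainder is
  at most \<open>L * (2 * r) ^ p\<close>; the choice of \<open>radius\<close> makes this linear in \<open>r\<close>.
\<close>

lemma model_error_le:
  assumes a: "0 < a" "0 < A" and x': "x' \<in> X" "norm (x' - prediction A a x g) \<le> radius a"
  shows "norm (prox_weight A a *\<^sub>R (F x' - taylor_model p (jet (query_point A a x g)) (query_point A a x g) x'))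
    \<le> norm (x' - prediction A a x g) / 16"
proof -
  define y where "y = query_point A a x g"
  define r where "r = norm (x' - prediction A a x g)"
  have "dist x' y \<le> dist x' (prediction A a x g) + dist (prediction A a x g) y"
    by (rule dist_triangle)
  also have "\<dots> \<le> 2 * r"
    using nearest_point_le[OF X(2) X_nonempty x'(1), of "prediction A a x g"]
    by (simp add: y_def query_point_def r_def dist_norm norm_minus_commute)
  finally have xy: "norm (x' - y) \<le> 2 * r" by (simp add: dist_norm)
  have r: "0 \<le> r" "r \<le> radius a" using x'(2) by (auto simp: r_def)
  have "norm (F x' - taylor_model p (jet y) y x') \<le> L * norm (x' - y) ^ p"
    using taylor_remainder[OF _ X(1,3) F(3) x'(1) query_point_in] p by (simp add: y_def)
  also have "\<dots> \<le> L * (2 * r) ^ p"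
    using xy L by (intro mult_left_mono power_mono) auto
  also have "\<dots> = L * 2 ^ p * r ^ (p - 1) * r"
  proof -
    have "r ^ p = r ^ (p - 1) * r" using p by (simp flip: power_Suc2)
    then show ?thesis by (simp add: power_mult_distrib)
  qed
  also have "\<dots> \<le> L * 2 ^ p * radius a ^ (p - 1) * r"
    using r L by (intro mult_left_mono mult_right_mono power_mono) auto
  also have "\<dots> = r / (16 * a)"
    unfolding radius_power[OF a(1)] using L a by simp
  finally have "prox_weight A a * norm (F x' - taylor_model p (jet y) y x') \<le> a * (r / (16 * a))"
    using prox_weight_bounds[OF a] by (intro mult_mono) auto
  then show ?thesis
    using a prox_weight_bounds[OF a] by (simp add: y_def r_def)
qed

definition anchored_step :: "real \<Rightarrow> real \<Rightarrow> fvec \<Rightarrow> fvec \<Rightarrow> fvec \<Rightarrow> fvec \<Rightarrow> bool"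
  where "anchored_step A a x g x' g' \<longleftrightarrow> (\<exists>e. norm e \<le> norm (g' - g) / 6 \<and>
    (A + a) *\<^sub>R (x' - x0) = A *\<^sub>R (x - x0) - (a * A) *\<^sub>R (g' - e))"

text \<open>
  A candidate misses the exact proximal equation by at most an eighth of its distance \<open>r\<close> from the prediction.
  As \<open>r\<close> itself is at most this defect plus \<open>\<lambda> \<parallel>g' - g\<parallel>\<close>, the defect is controlled by the change of
  the residual.
\<close>

lemma candidate_is_anchored_step:
  assumes a: "0 < a" "0 < A"
    and c: "(x', n) \<in> candidates A a x g (jet (query_point A a x g))"
  shows "anchored_step A a x g x' (F x' + n)"
proof -
  define lam where "lam = prox_weight A a"
  define T where "T = taylor_model p (jet (query_point A a x g)) (query_point A a x g) x'"
  define r where "r = norm (x' - prediction A a x g)"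
  define g' where "g' = F x' + n"
  define v where "v = x' + lam *\<^sub>R g' - prox_center A a x"
  have lam: "lam > 0" using prox_weight_bounds[OF a] by (simp add: lam_def)
  have c': "x' \<in> X" "r \<le> radius a" "norm (x' + lam *\<^sub>R (T + n) - prox_center A a x) \<le> r / 16"
    using c by (auto simp: candidates_def T_def r_def lam_def)
  have "norm (lam *\<^sub>R (F x' - T)) \<le> r / 16"
    using model_error_le[OF a c'(1)] c'(2) by (simp add: T_def r_def lam_def)
  moreover have "v = (x' + lam *\<^sub>R (T + n) - prox_center A a x) + lam *\<^sub>R (F x' - T)"
    by (simp add: v_def g'_def algebra_simps)
  ultimately have v: "norm v \<le> r / 8"
    using c'(3) norm_triangle_ineq[of "x' + lam *\<^sub>R (T + n) - prox_center A a x" "lam *\<^sub>R (F x' - T)"]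
    by simp
  have "x' - prediction A a x g = v - lam *\<^sub>R (g' - g)"
    by (simp add: v_def prediction_def lam_def algebra_simps)
  then have "r \<le> norm v + lam * norm (g' - g)"
    using norm_triangle_ineq4[of v "lam *\<^sub>R (g' - g)"] lam by (simp add: r_def)
  then have "norm v \<le> (lam * norm (g' - g)) / 6" using v norm_ge_zero[of v] by argo
  then have v': "norm v \<le> lam * (norm (g' - g) / 6)" by simp
  define e where "e = (1 / lam) *\<^sub>R v"
  have "norm e \<le> norm (g' - g) / 6"
    using v' lam by (simp add: e_def field_simps)
  moreover have "(A + a) *\<^sub>R (x' - x0) = A *\<^sub>R (x - x0) - (a * A) *\<^sub>R (g' - e)"
  proof -
    have "x' = prox_center A a x - lam *\<^sub>R (g' - e)"
      using lam by (simp add: e_def v_def scaleR_diff_right)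
    then have "x' - x0 = (A / (A + a)) *\<^sub>R (x - x0) - (a * A / (A + a)) *\<^sub>R (g' - e)"
      by (simp add: prox_center_def lam_def prox_weight_def)
    then show ?thesis using a by (simp add: scaleR_diff_right)
  qed
  ultimately show ?thesis unfolding anchored_step_def g'_def by blast
qed

text \<open>
  Within the trust radius the exact proximal step would itself be a candidate.
\<close>

lemma exact_step_rejected:
  assumes a: "0 < a" "0 < A" and none: "candidates A a x g (jet (query_point A a x g)) = {}"
    and xh: "xh \<in> X" "n \<in> normal_cone d X xh"
      "xh + prox_weight A a *\<^sub>R (F xh + n) = prox_center A a x"
  shows "radius a < norm (xh - prediction A a x g)"
proof (rule ccontr)
  assume "\<not> ?thesis"
  then have r: "norm (xh - prediction A a x g) \<le> radius a" by simp
  define T where "T = taylor_model p (jet (query_point A a x g)) (query_point A a x g) xh"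
  have "xh + prox_weight A a *\<^sub>R (T + n) - prox_center A a x = - (prox_weight A a *\<^sub>R (F xh - T))"
    using xh(3) by (simp add: algebra_simps)
  then have "norm (xh + prox_weight A a *\<^sub>R (T + n) - prox_center A a x)
      \<le> norm (xh - prediction A a x g) / 16"
    using model_error_le[OF a xh(1) r] by (simp add: T_def)
  then have "(xh, n) \<in> candidates A a x g (jet (query_point A a x g))"
    using xh r by (simp add: candidates_def T_def)
  then show False using none by blast
qed

lemma prox_center_in: "x \<in> X \<Longrightarrow> prox_center A a x \<in> Rn d"
  unfolding prox_center_def using X(1) x0 by (intro Rn_add Rn_scaleR Rn_diff) auto

text \<open>
  The energy that a rejected step of size \<open>a\<close> guarantees.
\<close>

definition threshold :: "real \<Rightarrow> real \<Rightarrow> real"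
  where "threshold A a = (A * radius a)\<^sup>2 / (72 * a\<^sup>2)"

text \<open>
  By rejection the exact full step is farther than the trust radius from the prediction, whereas two
  half steps with a small change of the residual would force it to be close. The assumption
  \<open>small\<close> keeps the discretisation error below half of the radius.
\<close>

lemma rejection_charges_energy:
  assumes a: "0 < a" "4 * a \<le> A" and none: "candidates A a x g (jet (query_point A a x g)) = {}"
    and x: "x \<in> X" and x2: "x2 \<in> X" "g2 \<in> residuals x2"
    and steps: "anchored_step A (a / 2) x g x1 g1" "anchored_step (A + a / 2) (a / 2) x1 g1 x2 g2"
    and small: "a * (a / A * norm g) \<le> radius a / 2"
  shows "threshold A a \<le> (A * norm (g1 - g))\<^sup>2 + ((A + a / 2) * norm (g2 - g1))\<^sup>2"
proof -
  have A: "A > 0" using a by linarith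
  define lam where "lam = prox_weight A a"
  have lam: "0 < lam" "lam \<le> a" using prox_weight_bounds[OF a(1) A] by (auto simp: lam_def)
  obtain xh n where xh: "xh \<in> X" "n \<in> normal_cone d X xh" "xh + lam *\<^sub>R (F xh + n) = prox_center A a x"
    using exact_step_exists[OF lam(1) prox_center_in[OF x]] by blast
  define S where "S = norm (g1 - g) + norm (g2 - g1)"
  obtain e1 e2 where e: "norm e1 \<le> norm (g1 - g) / 6" "norm e2 \<le> norm (g2 - g1) / 6"
    "(A + a / 2) *\<^sub>R (x1 - x0) = A *\<^sub>R (x - x0) - (a / 2 * A) *\<^sub>R (g1 - e1)"
    "(A + a) *\<^sub>R (x2 - x0) = (A + a / 2) *\<^sub>R (x1 - x0) - (a / 2 * (A + a / 2)) *\<^sub>R (g2 - e2)"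
    using steps unfolding anchored_step_def by (auto simp: add.assoc)
  have "0 \<le> inner (F xh + n - g2) (xh - x2)"
    by (intro residual_monotone residual_intro xh x2)
  from half_steps_predict_full_step[OF a e(3,4,1,2) _ _ xh(3) this]
  have "norm (xh - prediction A a x g) \<le> lam * (3 * S + a / A * norm g)"
    by (simp add: prediction_def lam_def prox_weight_def prox_center_def S_def)
  also have "\<dots> \<le> a * (3 * S + a / A * norm g)"
    using lam a A by (intro mult_right_mono) (auto simp: S_def)
  also have "\<dots> \<le> 3 * a * S + radius a / 2"
    using small by (simp add: algebra_simps)
  finally have "radius a \<le> 6 * a * S"
    using exact_step_rejected[OF a(1) A none xh(1,2)] xh(3) by (simp add: lam_def)
  then have "(radius a)\<^sup>2 \<le> (6 * a * S)\<^sup>2"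
    using radius_pos[OF a(1)] by (intro power_mono) auto
  also have "\<dots> \<le> 36 * a\<^sup>2 * (2 * ((norm (g1 - g))\<^sup>2 + (norm (g2 - g1))\<^sup>2))"
  proof -
    have "S\<^sup>2 \<le> 2 * ((norm (g1 - g))\<^sup>2 + (norm (g2 - g1))\<^sup>2)"
      using sum_squares_bound[of "norm (g1 - g)" "norm (g2 - g1)"] by (simp add: S_def power2_sum)
    from mult_left_mono[OF this, of "36 * a\<^sup>2"] show ?thesis by (simp add: power_mult_distrib)
  qed
  finally have "(radius a)\<^sup>2 / (72 * a\<^sup>2) \<le> (norm (g1 - g))\<^sup>2 + (norm (g2 - g1))\<^sup>2"
    using a by (simp add: field_simps)
  then have "A\<^sup>2 * ((radius a)\<^sup>2 / (72 * a\<^sup>2)) \<le> A\<^sup>2 * ((norm (g1 - g))\<^sup>2 + (norm (g2 - g1))\<^sup>2)"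
    by (intro mult_left_mono) auto
  also have "\<dots> \<le> (A * norm (g1 - g))\<^sup>2 + ((A + a / 2) * norm (g2 - g1))\<^sup>2"
    unfolding power_mult_distrib distrib_left
    using a A by (intro add_left_mono mult_right_mono power_mono) auto
  finally show ?thesis by (simp add: threshold_def power_mult_distrib)
qed

lemma threshold_half:
  assumes "0 < a" "0 < A" "A \<le> B"
  shows "4 * threshold A a \<le> threshold B (a / 2)"
proof -
  have "A * radius a \<le> B * radius (a / 2)"
    using assms radius_pos[of a] radius_antimono[of "a / 2" a] by (intro mult_mono) auto
  then have "(A * radius a)\<^sup>2 \<le> (B * radius (a / 2))\<^sup>2"
    using assms radius_pos[of a] by (intro power_mono) auto
  then show ?thesis using assms by (simp add: threshold_def field_simps)
qed

lemma threshold_pos: "0 < a \<Longrightarrow> 0 < A \<Longrightarrow> 0 < threshold A a"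
  using radius_pos[of a] by (simp add: threshold_def)

text \<open>
  The potential, shifted so as to be nonnegative at residuals of \<open>X\<close>.
\<close>

definition budget :: "real \<Rightarrow> fvec \<Rightarrow> fvec \<Rightarrow> real"
  where "budget A x g = potential x0 A x g + D\<^sup>2"

lemma residual_le_budget:
  assumes "x \<in> X" "g \<in> residuals x" "A \<ge> 0"
  shows "(A * norm g)\<^sup>2 \<le> 4 * budget A x g"
  unfolding budget_def
  by (rule potential_lower_bound[OF residual_obtuse[OF assms(1,2)] _ assms(3)]) (simp add: D)

lemma residual_le_distance:
  assumes "x \<in> X" "g \<in> residuals x" "A > 0" "budget A x g \<le> 20 * D\<^sup>2"
  shows "A * norm g \<le> 9 * D"
proof (rule power2_le_imp_le)
  show "(A * norm g)\<^sup>2 \<le> (9 * D)\<^sup>2"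
  proof -
    have "(A * norm g)\<^sup>2 \<le> 4 * budget A x g"
      using residual_le_budget[OF assms(1,2), of A] assms(3) by simp
    then have "(A * norm g)\<^sup>2 \<le> 81 * D\<^sup>2" using assms(4) zero_le_power2[of D] by linarith
    then show ?thesis by (simp add: power_mult_distrib)
  qed
qed (use D in simp)

text \<open>
  The exact step moves by an amount proportional to \<open>a\<close>, while the trust radius does not shrink with \<open>a\<close>.
  This is what makes repeated bisection stop.
\<close>

lemma short_step_accepted:
  assumes a: "0 < a" "0 < A" and x: "x \<in> X" "g \<in> residuals x"
    and small: "a * (2 * (norm (x - x0) + A * norm g)) \<le> A * radius a"
  shows "candidates A a x g (jet (query_point A a x g)) \<noteq> {}"
proof
  assume none: "candidates A a x g (jet (query_point A a x g)) = {}"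
  define lam where "lam = prox_weight A a"
  have lam: "0 < lam" using prox_weight_bounds[OF a] by (auto simp: lam_def)
  obtain xh n where xh: "xh \<in> X" "n \<in> normal_cone d X xh" "xh + lam *\<^sub>R (F xh + n) = prox_center A a x"
    using exact_step_exists[OF lam prox_center_in[OF x(1)]] by blast
  define v where "v = prox_center A a x - (x + lam *\<^sub>R g)"
  have "0 \<le> inner (F xh + n - g) (xh - x)"
    by (intro residual_monotone residual_intro xh x)
  from resolvent_stable[OF this, of lam] lam have "norm (xh - x) \<le> norm v"
    by (simp add: xh(3) v_def)
  moreover have "norm (xh - prediction A a x g) = norm ((xh - x) - v)"
    by (simp add: prediction_def v_def lam_def)
  ultimately have "norm (xh - prediction A a x g) \<le> 2 * norm v"
    using norm_triangle_ineq4[of "xh - x" v] by linarith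
  moreover have "norm v \<le> a / (A + a) * (norm (x - x0) + A * norm g)"
  proof -
    define c where "c = a / (A + a)"
    have c: "A / (A + a) = 1 - c" "a * A / (A + a) = c * A"
      using a by (auto simp: c_def field_simps)
    have "v = - (c *\<^sub>R ((x - x0) + A *\<^sub>R g))"
      unfolding v_def prox_center_def lam_def prox_weight_def c by (simp add: algebra_simps)
    then have "norm v = a / (A + a) * norm ((x - x0) + A *\<^sub>R g)" using a by (simp add: c_def)
    also have "\<dots> \<le> a / (A + a) * (norm (x - x0) + A * norm g)"
      using norm_triangle_ineq[of "x - x0" "A *\<^sub>R g"] a by (intro mult_left_mono) auto
    finally show ?thesis .
  qed
  moreover have "a / (A + a) * (norm (x - x0) + A * norm g) \<le> a / A * (norm (x - x0) + A * norm g)"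
    using a by (intro mult_right_mono divide_left_mono) auto
  moreover have "2 * (a / A * (norm (x - x0) + A * norm g)) \<le> radius a"
    using small a by (simp add: field_simps)
  ultimately have "norm (xh - prediction A a x g) \<le> radius a" by linarith
  then show False
    using exact_step_rejected[OF a none xh(1,2)] xh(3) by (simp add: lam_def)
qed

end

context anchored_method_analysis
begin

section \<open>Oracle calls spent on a step\<close>

text \<open>
  An accepted step costs two calls: one at the prediction, one at the new point.
\<close>

lemma accepted_step:
  assumes a: "0 < a" "4 * a \<le> A" and x: "x \<in> X" "g \<in> residuals x"
    and some: "candidates A a x g (jet (query_point A a x g)) \<noteq> {}"
  shows "\<exists>x' g'. runs jet A0 sched (Try A x g (a # as)) 2 (Try (A + a) x' g' as) \<and>
    x' \<in> X \<and> g' \<in> residuals x' \<and> anchored_step A a x g x' g'"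
proof -
  let ?J = "jet (query_point A a x g)"
  obtain x' n where c: "pick (candidates A a x g ?J) = (x', n)" by (cases "pick (candidates A a x g ?J)")
  have "(x', n) \<in> candidates A a x g ?J"
    using some unfolding c[symmetric] pick_def by (simp add: some_in_eq)
  then have x': "x' \<in> X" "n \<in> normal_cone d X x'" "anchored_step A a x g x' (F x' + n)"
    using candidate_is_anchored_step[of a A x' n x g] a by (auto simp: candidates_def)
  have eval: "runs jet A0 sched (Evaluate (A + a) x' n as) (Suc 0) (Try (A + a) x' (F x' + n) as)"
    using x'(1) X(1) runs_refl[of jet A0 sched "Try (A + a) x' (F x' + n) as"]
    by (intro runs_query[of _ x']) (auto simp: jet_value)
  have "runs jet A0 sched (Try A x g (a # as)) (Suc (Suc 0)) (Try (A + a) x' (F x' + n) as)"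
    by (rule runs_query[of _ "query_point A a x g"])
      (use eval query_point_in[of A a x g] X(1) some c in auto)
  then show ?thesis
    using x' residual_intro by (metis numeral_2_eq_2)
qed

lemma anchored_step_budget:
  assumes a: "0 < a" "4 * a \<le> A" and x: "x \<in> X" "g \<in> residuals x"
    and x': "x' \<in> X" "g' \<in> residuals x'" and step: "anchored_step A a x g x' g'"
    and le: "budget A x g \<le> 20 * D\<^sup>2"
  shows "budget (A + a) x' g' + (A * norm (g' - g))\<^sup>2 / 8 \<le> budget A x g + 160 * D\<^sup>2 * (a / A)\<^sup>2"
proof -
  have A: "A > 0" using a by linarith
  obtain e where "norm e \<le> norm (g' - g) / 6"
    "(A + a) *\<^sub>R (x' - x0) = A *\<^sub>R (x - x0) - (a * A) *\<^sub>R (g' - e)"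
    using step unfolding anchored_step_def by blast
  from anchored_step_decrease[OF a this(2,1) residual_monotone[OF x'(1) x(1) x'(2) x(2)]]
  have "budget (A + a) x' g' + (A * norm (g' - g))\<^sup>2 / 8 \<le> budget A x g + 2 * (a * norm g)\<^sup>2"
    by (simp add: budget_def)
  also have "2 * (a * norm g)\<^sup>2 = 2 * (a / A)\<^sup>2 * (A * norm g)\<^sup>2"
    using A by (simp add: power_mult_distrib power_divide)
  also have "\<dots> \<le> 2 * (a / A)\<^sup>2 * (80 * D\<^sup>2)"
    using residual_le_budget[OF x, of A] A le by (intro mult_left_mono) auto
  finally show ?thesis by (simp add: mult_ac)
qed

lemma budget_nonneg: "x \<in> X \<Longrightarrow> g \<in> residuals x \<Longrightarrow> A \<ge> 0 \<Longrightarrow> 0 \<le> budget A x g"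
  using residual_le_budget[of x g A] zero_le_power2[of "A * norm g"] by linarith

text \<open>
  Induction on the depth \<open>n\<close> after which steps are short enough to be accepted. The disjunction in the
  conclusion is the invariant that carries the count of calls: either the step was accepted as it is, or it has
  used the energy \<open>threshold A a\<close>. For a rejected step this follows from the same statement about its
  halves: if one half was rejected, its own threshold is already large enough, and if both
  were accepted, \<open>rejection_charges_energy\<close> applies. As thresholds quadruple under halving, the calls
  of both halves and of the rejected attempt fit into the bound for the full step.
\<close>

lemma advance_by_bisection:
  assumes "0 < a" "4 * a \<le> A" "A1 \<le> A" "0 < A1" "x \<in> X" "g \<in> residuals x"
    and "budget A x g + 160 * D\<^sup>2 * (a / A)\<^sup>2 \<le> 20 * D\<^sup>2"
    and "a\<^sup>2 * (9 * D) / A\<^sup>2 \<le> radius a / 2"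
    and "\<And>y. y \<in> X \<Longrightarrow> norm (y - x0) \<le> H"
    and "a * (2 * (H + 9 * D)) \<le> 2 ^ n * (A1 * radius a)"
  shows "\<exists>N x' g' E. runs jet A0 sched (Try A x g (a # as)) N (Try (A + a) x' g' as) \<and>
    x' \<in> X \<and> g' \<in> residuals x' \<and> 0 \<le> E \<and>
    budget (A + a) x' g' + E / 8 \<le> budget A x g + 160 * D\<^sup>2 * (a / A)\<^sup>2 \<and>
    real N \<le> 2 + 6 * E / threshold A a \<and>
    (anchored_step A a x g x' g' \<and> E = (A * norm (g' - g))\<^sup>2 \<or> threshold A a \<le> E)"
  using assms
proof (induction n arbitrary: a A x g as)
  case (0 a A x g as)
  have A: "A > 0" using 0 by linarith
  have le: "budget A x g \<le> 20 * D\<^sup>2"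
    using "0.prems"(7) zero_le_power2[of "a / A"] by (smt (verit) mult_nonneg_nonneg zero_le_power2)
  have "a * (2 * (norm (x - x0) + A * norm g)) \<le> a * (2 * (H + 9 * D))"
    using "0.prems"(1,5,9) residual_le_distance[OF "0.prems"(5,6) A le]
    by (intro mult_left_mono add_mono) auto
  also have "\<dots> \<le> A1 * radius a" using "0.prems"(10) by simp
  also have "\<dots> \<le> A * radius a"
    using "0.prems"(1,3) radius_pos[of a] by (intro mult_right_mono) auto
  finally have "candidates A a x g (jet (query_point A a x g)) \<noteq> {}"
    by (intro short_step_accepted "0.prems" A)
  from accepted_step[OF "0.prems"(1,2,5,6) this, of A0 sched as]
  obtain x' g' where s: "runs jet A0 sched (Try A x g (a # as)) 2 (Try (A + a) x' g' as)"
      "x' \<in> X" "g' \<in> residuals x'" "anchored_step A a x g x' g'"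
    by blast
  have "budget (A + a) x' g' + (A * norm (g' - g))\<^sup>2 / 8 \<le> budget A x g + 160 * D\<^sup>2 * (a / A)\<^sup>2"
    by (intro anchored_step_budget "0.prems" s le)
  moreover have "real 2 \<le> 2 + 6 * (A * norm (g' - g))\<^sup>2 / threshold A a"
    using threshold_pos[OF "0.prems"(1) A] by simp
  ultimately show ?case
    using s by (intro exI[of _ 2] exI[of _ x'] exI[of _ g'] exI[of _ "(A * norm (g' - g))\<^sup>2"]) simp
next
  case (Suc n a A x g as)
  have A: "A > 0" using Suc.prems by linarith
  have le: "budget A x g \<le> 20 * D\<^sup>2"
    using Suc.prems(7) by (smt (verit) mult_nonneg_nonneg zero_le_power2)
  show ?case
  proof (cases "candidates A a x g (jet (query_point A a x g)) = {}")
    case False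
    from accepted_step[OF Suc.prems(1,2,5,6) this, of A0 sched as]
    obtain x' g' where s: "runs jet A0 sched (Try A x g (a # as)) 2 (Try (A + a) x' g' as)"
        "x' \<in> X" "g' \<in> residuals x'" "anchored_step A a x g x' g'"
      by blast
    have "budget (A + a) x' g' + (A * norm (g' - g))\<^sup>2 / 8 \<le> budget A x g + 160 * D\<^sup>2 * (a / A)\<^sup>2"
      by (intro anchored_step_budget Suc.prems s le)
    moreover have "real 2 \<le> 2 + 6 * (A * norm (g' - g))\<^sup>2 / threshold A a"
      using threshold_pos[OF Suc.prems(1) A] by simp
    ultimately show ?thesis
      using s by (intro exI[of _ 2] exI[of _ x'] exI[of _ g'] exI[of _ "(A * norm (g' - g))\<^sup>2"]) simp
  next
    case none: True
    \<comment> \<open>The rejected attempt costs one call, then both halves are processed.\<close>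
    define b where "b = a / 2"
    have b: "0 < b" "4 * b \<le> A" "b \<le> a" using Suc.prems by (auto simp: b_def)
    have rad: "radius a \<le> radius b" "0 < radius a"
      using radius_antimono[OF b(1,3)] radius_pos Suc.prems(1) by auto
    have sq: "160 * D\<^sup>2 * (b / A)\<^sup>2 = 160 * D\<^sup>2 * (a / A)\<^sup>2 / 4"
      by (simp add: b_def power_divide)
    have sq': "160 * D\<^sup>2 * (b / (A + b))\<^sup>2 \<le> 160 * D\<^sup>2 * (a / A)\<^sup>2 / 4"
      unfolding sq[symmetric]
      using b A by (intro mult_left_mono power_mono divide_left_mono) auto
    have pos: "0 \<le> 160 * D\<^sup>2 * (a / A)\<^sup>2" by simp
    have mult: "b * (2 * (H + 9 * D)) \<le> 2 ^ n * (A1 * radius b)"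
    proof -
      have "b * (2 * (H + 9 * D)) \<le> 2 ^ n * (A1 * radius a)"
        using Suc.prems(10) by (simp add: b_def)
      also have "\<dots> \<le> 2 ^ n * (A1 * radius b)"
        using rad Suc.prems(4) by (intro mult_left_mono) auto
      finally show ?thesis .
    qed
    have small: "b\<^sup>2 * (9 * D) / B\<^sup>2 \<le> radius b / 2" if "A \<le> B" for B
    proof -
      have "b\<^sup>2 * (9 * D) / B\<^sup>2 \<le> a\<^sup>2 * (9 * D) / A\<^sup>2"
        using b A that D by (intro frac_le mult_right_mono power_mono mult_nonneg_nonneg) auto
      then show ?thesis using Suc.prems(8) rad by linarith
    qed
    have "runs jet A0 sched (Try A x g (a # as)) (Suc 0) (Try A x g (b # b # as))"
      using none query_point_in[of A a x g] X(1) runs_refl[of jet A0 sched "Try A x g (b # b # as)"]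
      by (intro runs_query[of _ "query_point A a x g"]) (auto simp: b_def)
    moreover obtain N1 x1 g1 E1 where
      s1: "runs jet A0 sched (Try A x g (b # b # as)) N1 (Try (A + b) x1 g1 (b # as))"
        "x1 \<in> X" "g1 \<in> residuals x1" "0 \<le> E1"
        "budget (A + b) x1 g1 + E1 / 8 \<le> budget A x g + 160 * D\<^sup>2 * (b / A)\<^sup>2"
        "real N1 \<le> 2 + 6 * E1 / threshold A b"
        "anchored_step A b x g x1 g1 \<and> E1 = (A * norm (g1 - g))\<^sup>2 \<or> threshold A b \<le> E1"
      using Suc.IH[OF b(1,2) Suc.prems(3-6) _ small[OF order_refl] Suc.prems(9) mult, of "b # as"]
        Suc.prems(7) sq pos by auto
    moreover obtain N2 x2 g2 E2 where
      s2: "runs jet A0 sched (Try (A + b) x1 g1 (b # as)) N2 (Try (A + b + b) x2 g2 as)"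
        "x2 \<in> X" "g2 \<in> residuals x2" "0 \<le> E2"
        "budget (A + b + b) x2 g2 + E2 / 8 \<le> budget (A + b) x1 g1 + 160 * D\<^sup>2 * (b / (A + b))\<^sup>2"
        "real N2 \<le> 2 + 6 * E2 / threshold (A + b) b"
        "anchored_step (A + b) b x1 g1 x2 g2 \<and> E2 = ((A + b) * norm (g2 - g1))\<^sup>2 \<or> threshold (A + b) b \<le> E2"
      using Suc.IH[OF b(1) _ _ Suc.prems(4) s1(2,3) _ small Suc.prems(9) mult, of "A + b" as]
        Suc.prems(3,7) sq sq' pos s1(4,5) b by auto
    ultimately have run: "runs jet A0 sched (Try A x g (a # as)) (Suc 0 + (N1 + N2)) (Try (A + a) x2 g2 as)"
      using runs_trans by (metis add.assoc b_def field_sum_of_halves)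
    have ab: "A + b + b = A + a" by (simp add: b_def)
    define Q where "Q = threshold A a"
    have Q: "0 < Q" "4 * Q \<le> threshold A b" "4 * Q \<le> threshold (A + b) b"
      using threshold_pos[OF Suc.prems(1) A] threshold_half[OF Suc.prems(1) A] b by (auto simp: Q_def b_def)
    have E: "Q \<le> E1 + E2"
    proof (cases "threshold A b \<le> E1 \<or> threshold (A + b) b \<le> E2")
      case True
      then show ?thesis using Q s1(4) s2(4) by linarith
    next
      case False
      have "A * norm g \<le> 9 * D" by (rule residual_le_distance[OF Suc.prems(5,6) A le])
      then have "a\<^sup>2 / A\<^sup>2 * (A * norm g) \<le> a\<^sup>2 / A\<^sup>2 * (9 * D)" by (intro mult_left_mono) auto
      moreover have "a\<^sup>2 / A\<^sup>2 * (9 * D) = a\<^sup>2 * (9 * D) / A\<^sup>2" by simp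
      moreover have "a * (a / A * norm g) = a\<^sup>2 / A\<^sup>2 * (A * norm g)"
        using A by (simp add: power2_eq_square)
      ultimately have "a * (a / A * norm g) \<le> radius a / 2"
        using Suc.prems(8) by linarith
      from rejection_charges_energy[OF Suc.prems(1,2) none Suc.prems(5) s2(2,3) _ _ this] False s1(7) s2(7)
      show ?thesis by (auto simp: Q_def b_def)
    qed
    have "real (Suc 0 + (N1 + N2)) \<le> 5 + 6 * E1 / threshold A b + 6 * E2 / threshold (A + b) b"
      using s1(6) s2(6) by simp
    also have "\<dots> \<le> 5 + 6 * E1 / (4 * Q) + 6 * E2 / (4 * Q)"
      using Q s1(4) s2(4) by (intro add_mono frac_le) auto
    also have "\<dots> \<le> 2 + 6 * (E1 + E2) / Q"
    proof -
      have "1 \<le> (E1 + E2) / Q" using E Q by simp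
      moreover have "6 * E1 / (4 * Q) + 6 * E2 / (4 * Q) = 3 / 2 * ((E1 + E2) / Q)"
        using Q by (simp add: field_simps)
      moreover have "6 * (E1 + E2) / Q = 6 * ((E1 + E2) / Q)" by simp
      ultimately show ?thesis by linarith
    qed
    finally have "real (Suc 0 + (N1 + N2)) \<le> 2 + 6 * (E1 + E2) / Q" .
    moreover have "budget (A + a) x2 g2 + (E1 + E2) / 8 \<le> budget A x g + 160 * D\<^sup>2 * (a / A)\<^sup>2"
      using s1(5) s2(5) sq sq' pos unfolding ab by argo
    ultimately show ?thesis
      using run s2(2,3) s1(4) s2(4) E unfolding Q_def
      by (intro exI[of _ "Suc 0 + (N1 + N2)"] exI[of _ x2] exI[of _ g2] exI[of _ "E1 + E2"]) auto
  qed
qed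

text \<open>
  The exact proximal step from \<open>x0\<close> moves by at most \<open>D\<close>, since \<open>xs\<close> is a zero of the monotone operator. At
  distance \<open>D\<close> the Taylor remainder is at most \<open>L * D ^ p\<close>, so a weight \<open>A0\<close> with \<open>A0 * (L * D ^ p) \<le> D\<close>
  makes this step a candidate.
\<close>

lemma start_succeeds:
  assumes A0: "0 < A0" "A0 * (L * D ^ p) \<le> D"
  shows "\<exists>x g. runs jet A0 sched Start 2 (Try A0 x g sched) \<and> x \<in> X \<and> g \<in> residuals x \<and>
    budget A0 x g \<le> 10 * D\<^sup>2"
proof -
  have model: "norm (A0 *\<^sub>R (F x - taylor_model p (jet x0) x0 x)) \<le> D"
    if x: "x \<in> X" "norm (x - x0) \<le> D" for x
  proof -
    have "norm (F x - taylor_model p (jet x0) x0 x) \<le> L * norm (x - x0) ^ p"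
      using taylor_remainder[OF _ X(1,3) F(3) x(1) x0] p by simp
    also have "\<dots> \<le> L * D ^ p" using x L by (intro mult_left_mono power_mono) auto
    finally have "A0 * norm (F x - taylor_model p (jet x0) x0 x) \<le> A0 * (L * D ^ p)"
      using A0 by (intro mult_left_mono) auto
    also have "\<dots> \<le> D" by (rule A0(2))
    finally show ?thesis using A0 by simp
  qed
  obtain xh n where xh: "xh \<in> X" "n \<in> normal_cone d X xh" "xh + A0 *\<^sub>R (F xh + n) = x0"
    using exact_step_exists[OF A0(1)] x0 X(1) by blast
  have "norm (xh - x0) \<le> D"
  proof -
    have eq: "A0 *\<^sub>R (F xh + n) = x0 - xh" using xh(3) by (metis add_diff_cancel_left')
    have "0 \<le> A0 * inner (F xh + n) (xh - xs)"
      using residual_obtuse[OF xh(1) residual_intro[OF xh(2)]] A0 by simp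
    also have "\<dots> = inner (x0 - xh) (xh - xs)" by (simp only: eq[symmetric] inner_scaleR_left)
    finally have "inner (x0 - xh) (x0 - xh) \<le> inner (x0 - xh) (x0 - xs)"
      by (simp add: inner_diff_right)
    also have "\<dots> \<le> norm (x0 - xh) * D"
      using norm_cauchy_schwarz[of "x0 - xh" "x0 - xs"] by (simp add: D)
    finally have "norm (x0 - xh) * norm (x0 - xh) \<le> norm (x0 - xh) * D"
      by (simp add: power2_norm_eq_inner[symmetric] power2_eq_square)
    then show ?thesis
      using D(2) by (cases "x0 = xh") (auto simp: mult_le_cancel_left norm_minus_commute)
  qed
  moreover have "xh + A0 *\<^sub>R (taylor_model p (jet x0) x0 xh + n) - x0
      = - (A0 *\<^sub>R (F xh - taylor_model p (jet x0) x0 xh))"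
    using xh(3) by (simp add: algebra_simps)
  ultimately have "(xh, n) \<in> start_candidates A0 (jet x0)"
    using model[OF xh(1)] xh by (auto simp: start_candidates_def)
  then have some: "start_candidates A0 (jet x0) \<noteq> {}" by blast
  obtain x n where c: "pick (start_candidates A0 (jet x0)) = (x, n)"
    by (cases "pick (start_candidates A0 (jet x0))")
  have "(x, n) \<in> start_candidates A0 (jet x0)"
    using some unfolding c[symmetric] pick_def by (simp add: some_in_eq)
  then have x: "x \<in> X" "n \<in> normal_cone d X x" "norm (x - x0) \<le> D"
      "norm (x + A0 *\<^sub>R (taylor_model p (jet x0) x0 x + n) - x0) \<le> D"
    by (auto simp: start_candidates_def)
  define g where "g = F x + n"
  have eval: "runs jet A0 sched (Evaluate A0 x n sched) (Suc 0) (Try A0 x g sched)"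
    using x(1) X(1) runs_refl[of jet A0 sched "Try A0 x (F x + n) sched"]
    by (intro runs_query[of _ x]) (auto simp: jet_value g_def)
  have "runs jet A0 sched Start (Suc (Suc 0)) (Try A0 x g sched)"
    by (rule runs_query[of _ x0]) (use eval c x0 X(1) in auto)
  moreover have "budget A0 x g \<le> 10 * D\<^sup>2"
  proof -
    have "A0 *\<^sub>R g = (x + A0 *\<^sub>R (taylor_model p (jet x0) x0 x + n) - x0)
        + A0 *\<^sub>R (F x - taylor_model p (jet x0) x0 x) - (x - x0)"
      by (simp add: g_def algebra_simps)
    then have "norm (A0 *\<^sub>R g) \<le> norm (x + A0 *\<^sub>R (taylor_model p (jet x0) x0 x + n) - x0)
        + norm (A0 *\<^sub>R (F x - taylor_model p (jet x0) x0 x)) + norm (x - x0)"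
      by (metis norm_triangle_ineq norm_triangle_ineq4 add_right_mono order_trans)
    also have "\<dots> \<le> D + D + D" using x model[OF x(1,3)] by (intro add_mono) auto
    finally have Ag: "A0 * norm g \<le> 3 * D" using A0 by simp
    have "A0 * inner g (x - x0) \<le> A0 * (norm g * norm (x - x0))"
      using A0 norm_cauchy_schwarz by (intro mult_left_mono) auto
    also have "\<dots> = (A0 * norm g) * norm (x - x0)" by simp
    also have "\<dots> \<le> (3 * D) * D" using D(2) by (intro mult_mono[OF Ag x(3)]) auto
    finally have 1: "A0 * inner g (x - x0) \<le> 3 * D\<^sup>2" by (simp add: power2_eq_square)
    have "(A0 * norm g)\<^sup>2 \<le> (3 * D)\<^sup>2" using Ag A0 by (intro power_mono) auto
    then have "A0\<^sup>2 / 2 * (norm g)\<^sup>2 \<le> 9 / 2 * D\<^sup>2" by (simp add: power_mult_distrib)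
    with 1 zero_le_power2[of D] show ?thesis unfolding budget_def potential_def by linarith
  qed
  ultimately show ?thesis
    using x(1) residual_intro[OF x(2)] unfolding g_def by (metis numeral_2_eq_2)
qed

end

context anchored_method_analysis
begin

section \<open>Oracle calls spent on a schedule\<close>

text \<open>
  The budget grows by \<open>160 * D\<^sup>2 * (a / S i)\<^sup>2\<close> at index \<open>i\<close>, which is at most \<open>w / i\<^sup>2\<close>. Adding \<open>w / (i - 1)\<close>
  to the budget compensates for this growth, because \<open>1 / i\<^sup>2 \<le> 1 / (i - 1) - 1 / i\<close>.
\<close>

lemma follow_schedule:
  fixes S :: "nat \<Rightarrow> real" and M :: real
  defines "w \<equiv> 160 * D\<^sup>2 * M\<^sup>2"
  assumes sched: "\<And>i. i \<ge> k0 \<Longrightarrow> 0 < S i" "\<And>i. i \<ge> k0 \<Longrightarrow> S i < S (Suc i)"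
      "\<And>i. i \<ge> k0 \<Longrightarrow> 4 * (S (Suc i) - S i) \<le> S i"
      "\<And>i. i \<ge> k0 \<Longrightarrow> (S (Suc i) - S i) / S i \<le> M / real i"
      "\<And>i. i \<ge> k0 \<Longrightarrow> (S (Suc i) - S i)\<^sup>2 * (9 * D) / (S i)\<^sup>2 \<le> radius (S (Suc i) - S i) / 2"
      "\<And>i. i \<ge> k0 \<Longrightarrow> D\<^sup>2 / real i \<le> threshold (S i) (S (Suc i) - S i)"
    and k: "k0 \<ge> 2" "k \<ge> k0"
    and x: "x \<in> X" "g \<in> residuals x" "budget (S k) x g + w / (real k - 1) \<le> 20 * D\<^sup>2"
  shows "\<exists>N x' g' E.
    runs jet A0 steps (Try (S k) x g (map (\<lambda>i. S (Suc i) - S i) [k..<k + j])) N (Try (S (k + j)) x' g' []) \<and>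
    x' \<in> X \<and> g' \<in> residuals x' \<and> 0 \<le> E \<and>
    budget (S (k + j)) x' g' + E / 8 + w / (real (k + j) - 1) \<le> budget (S k) x g + w / (real k - 1) \<and>
    real N \<le> 2 * real j + 6 * real (k + j) / D\<^sup>2 * E"
  using k(2) x
proof (induction j arbitrary: k x g)
  case 0
  then show ?case
    by (intro exI[of _ 0] exI[of _ x] exI[of _ g] exI[of _ "0::real"]) (auto intro: runs_refl)
next
  case (Suc j k x g)
  define a where "a = S (Suc k) - S k"
  note s = sched[OF Suc.prems(1), folded a_def]
  have Sk: "S k + a = S (Suc k)" and a: "0 < a" using s by (auto simp: a_def)
  have k2: "real k \<ge> 2" using k Suc.prems(1) by simp
  have w: "0 \<le> w" by (simp add: w_def)
  have drop: "160 * D\<^sup>2 * (a / S k)\<^sup>2 + w / real k \<le> w / (real k - 1)"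
  proof -
    have "(a / S k)\<^sup>2 \<le> (M / real k)\<^sup>2"
      using s a by (intro power_mono) auto
    then have "160 * D\<^sup>2 * (a / S k)\<^sup>2 \<le> 160 * D\<^sup>2 * (M / real k)\<^sup>2"
      by (intro mult_left_mono) auto
    also have "\<dots> = w * (1 / (real k * real k))"
      by (simp add: w_def power_divide power2_eq_square)
    also have "\<dots> \<le> w * (1 / ((real k - 1) * real k))"
      using k2 w by (intro mult_left_mono divide_left_mono mult_right_mono) auto
    also have "1 / ((real k - 1) * real k) = 1 / (real k - 1) - 1 / real k"
      using k2 by (simp add: field_simps)
    finally show ?thesis by (simp add: right_diff_distrib)
  qed
  have "bounded ((\<lambda>y. y - x0) ` X)"
    by (intro compact_imp_bounded compact_continuous_image X continuous_intros)
  then obtain H where H: "\<And>y. y \<in> X \<Longrightarrow> norm (y - x0) \<le> H"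
    unfolding bounded_iff by blast
  have Sr: "0 < S k * radius a" using s radius_pos[OF a] by simp
  obtain n where "a * (2 * (H + 9 * D)) / (S k * radius a) < 2 ^ n"
    using real_arch_pow[of 2] by auto
  then have n: "a * (2 * (H + 9 * D)) \<le> 2 ^ n * (S k * radius a)"
    using Sr by (simp add: pos_divide_less_eq)
  have "0 \<le> w / real k" using w by simp
  with drop Suc.prems(4) have "budget (S k) x g + 160 * D\<^sup>2 * (a / S k)\<^sup>2 \<le> 20 * D\<^sup>2" by linarith
  from advance_by_bisection[OF a s(3) order_refl s(1) Suc.prems(2,3) this s(5) H n,
      of A0 steps "map (\<lambda>i. S (Suc i) - S i) [Suc k..<k + Suc j]"]
  obtain N1 x1 g1 E1 where
    r1: "runs jet A0 steps (Try (S k) x g (a # map (\<lambda>i. S (Suc i) - S i) [Suc k..<k + Suc j])) N1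
        (Try (S (Suc k)) x1 g1 (map (\<lambda>i. S (Suc i) - S i) [Suc k..<k + Suc j]))"
    and s1: "x1 \<in> X" "g1 \<in> residuals x1" "0 \<le> E1"
      "budget (S (Suc k)) x1 g1 + E1 / 8 \<le> budget (S k) x g + 160 * D\<^sup>2 * (a / S k)\<^sup>2"
      "real N1 \<le> 2 + 6 * E1 / threshold (S k) a"
    unfolding Sk by blast
  have b1: "budget (S (Suc k)) x1 g1 + E1 / 8 + w / (real (Suc k) - 1) \<le> budget (S k) x g + w / (real k - 1)"
    using s1(4) drop by simp
  have "budget (S (Suc k)) x1 g1 + w / (real (Suc k) - 1) \<le> 20 * D\<^sup>2"
    using b1 s1(3) Suc.prems(4) by linarith
  from Suc.IH[OF le_SucI[OF Suc.prems(1)] s1(1,2) this]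
  obtain N2 x2 g2 E2 where
    r2: "runs jet A0 steps (Try (S (Suc k)) x1 g1 (map (\<lambda>i. S (Suc i) - S i) [Suc k..<Suc k + j])) N2
        (Try (S (Suc k + j)) x2 g2 [])"
    and s2: "x2 \<in> X" "g2 \<in> residuals x2" "0 \<le> E2"
      "budget (S (Suc k + j)) x2 g2 + E2 / 8 + w / (real (Suc k + j) - 1)
        \<le> budget (S (Suc k)) x1 g1 + w / (real (Suc k) - 1)"
      "real N2 \<le> 2 * real j + 6 * real (Suc k + j) / D\<^sup>2 * E2"
    by blast
  have list: "map (\<lambda>i. S (Suc i) - S i) [k..<k + Suc j]
      = a # map (\<lambda>i. S (Suc i) - S i) [Suc k..<k + Suc j]"
    by (simp add: upt_conv_Cons a_def del: upt_Suc)
  have run: "runs jet A0 steps (Try (S k) x g (map (\<lambda>i. S (Suc i) - S i) [k..<k + Suc j])) (N1 + N2)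
      (Try (S (k + Suc j)) x2 g2 [])"
    unfolding list using runs_trans[OF r1, of N2] r2 by simp
  have "6 * E1 / threshold (S k) a \<le> 6 * real (k + Suc j) / D\<^sup>2 * E1"
  proof -
    have "6 * E1 / threshold (S k) a \<le> 6 * E1 / (D\<^sup>2 / real k)"
      using s(6) s1(3) k2 D(2) by (intro divide_left_mono mult_pos_pos) (auto intro: threshold_pos a s)
    also have "\<dots> = 6 * real k / D\<^sup>2 * E1" by simp
    also have "\<dots> \<le> 6 * real (k + Suc j) / D\<^sup>2 * E1"
      using s1(3) by (intro mult_right_mono divide_right_mono) auto
    finally show ?thesis .
  qed
  then have "real (N1 + N2) \<le> 2 * real (Suc j) + 6 * real (k + Suc j) / D\<^sup>2 * (E1 + E2)"
    using s1(5) s2(5) by (simp add: distrib_left)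
  moreover have "budget (S (k + Suc j)) x2 g2 + (E1 + E2) / 8 + w / (real (k + Suc j) - 1)
      \<le> budget (S k) x g + w / (real k - 1)"
    using s2(4) b1 by (simp add: add_divide_distrib)
  ultimately show ?case
    using run s1(3) s2(1,2,3) by (intro exI[of _ "N1 + N2"] exI[of _ x2] exI[of _ g2] exI[of _ "E1 + E2"]) simp
qed

text \<open>
  The budget never exceeds \<open>20 * D\<^sup>2\<close>, hence the total energy is at most \<open>160 * D\<^sup>2\<close>. A threshold of at least
  \<open>D\<^sup>2 / i\<close> turns this into at most \<open>960 * K\<close> calls caused by rejections.
\<close>

lemma strategy_returns_solution:
  fixes S :: "nat \<Rightarrow> real" and M :: real
  assumes sched: "\<And>i. i \<ge> k0 \<Longrightarrow> 0 < S i" "\<And>i. i \<ge> k0 \<Longrightarrow> S i < S (Suc i)"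
      "\<And>i. i \<ge> k0 \<Longrightarrow> 4 * (S (Suc i) - S i) \<le> S i"
      "\<And>i. i \<ge> k0 \<Longrightarrow> (S (Suc i) - S i) / S i \<le> M / real i"
      "\<And>i. i \<ge> k0 \<Longrightarrow> (S (Suc i) - S i)\<^sup>2 * (9 * D) / (S i)\<^sup>2 \<le> radius (S (Suc i) - S i) / 2"
      "\<And>i. i \<ge> k0 \<Longrightarrow> D\<^sup>2 / real i \<le> threshold (S i) (S (Suc i) - S i)"
    and k0: "k0 \<ge> 2" "16 * M\<^sup>2 \<le> real k0 - 1" "k0 \<le> K"
    and S0: "S k0 * (L * D ^ p) \<le> D" and eps: "9 * D \<le> S K * \<epsilon>"
  shows "\<exists>T x. returns (Rn d) jet (strategy (S k0) (map (\<lambda>i. S (Suc i) - S i) [k0..<K])) [] T x \<and>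
    x \<in> X \<and> infdist 0 (residuals x) \<le> \<epsilon> \<and> real T \<le> 963 * real K"
proof -
  define steps where "steps = map (\<lambda>i. S (Suc i) - S i) [k0..<K]"
  obtain x g where r0: "runs jet (S k0) steps Start 2 (Try (S k0) x g steps)"
    and x: "x \<in> X" "g \<in> residuals x" "budget (S k0) x g \<le> 10 * D\<^sup>2"
    using start_succeeds[OF sched(1)[OF order_refl] S0] by blast
  have "160 * D\<^sup>2 * M\<^sup>2 / (real k0 - 1) \<le> 10 * D\<^sup>2"
  proof -
    have "(10 * D\<^sup>2) * (16 * M\<^sup>2) \<le> (10 * D\<^sup>2) * (real k0 - 1)"
      by (intro mult_left_mono k0) auto
    then show ?thesis using k0(1) by (simp add: pos_divide_le_eq)
  qed
  then have le: "budget (S k0) x g + 160 * D\<^sup>2 * M\<^sup>2 / (real k0 - 1) \<le> 20 * D\<^sup>2" using x(3) by linarith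
  have K: "k0 + (K - k0) = K" using k0 by simp
  from follow_schedule[of k0 S M k0 x g "S k0" steps "K - k0", OF sched k0(1) order_refl x(1,2) le]
  obtain N x' g' E where r: "runs jet (S k0) steps (Try (S k0) x g steps) N (Try (S K) x' g' [])"
    and x': "x' \<in> X" "g' \<in> residuals x'" "0 \<le> E"
      "budget (S K) x' g' + E / 8 + 160 * D\<^sup>2 * M\<^sup>2 / (real K - 1)
        \<le> budget (S k0) x g + 160 * D\<^sup>2 * M\<^sup>2 / (real k0 - 1)"
      "real N \<le> 2 * real (K - k0) + 6 * real K / D\<^sup>2 * E"
    unfolding K steps_def by blast
  have SK: "S K > 0" using sched(1) k0 by simp
  have "0 \<le> 160 * D\<^sup>2 * M\<^sup>2 / (real K - 1)" using k0 by simp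
  then have bE: "budget (S K) x' g' + E / 8 \<le> 20 * D\<^sup>2" using x'(4) le by linarith
  have "E \<le> 160 * D\<^sup>2" using bE budget_nonneg[OF x'(1,2), of "S K"] SK by linarith
  then have "6 * real K / D\<^sup>2 * E \<le> 6 * real K / D\<^sup>2 * (160 * D\<^sup>2)" by (intro mult_left_mono) auto
  also have "\<dots> = 960 * real K" using D(2) by simp
  finally have "real (2 + N) \<le> 963 * real K"
    using x'(5) k0 by simp
  moreover have "returns (Rn d) jet (strategy (S k0) steps) [] (2 + N) x'"
    by (rule runs_imp_returns[OF runs_trans[OF r0 r]]) auto
  moreover have "infdist 0 (residuals x') \<le> \<epsilon>"
  proof -
    have "S K * norm g' \<le> 9 * D"
      by (rule residual_le_distance[OF x'(1,2) SK]) (use bE x'(3) in linarith)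
    also have "\<dots> \<le> S K * \<epsilon>" by (rule eps)
    finally have "norm g' \<le> \<epsilon>" using SK by simp
    then show ?thesis using infdist_le[OF x'(2), of 0] by simp
  qed
  ultimately show ?thesis using x'(1) unfolding steps_def by blast
qed

end

section \<open>Polynomial schedule of anchor weights\<close>

text \<open>
  The constants below depend on \<open>p\<close> only. \<open>growth p\<close> bounds \<open>i\<close> times the relative increment of the schedule,
  \<open>first_index p\<close> is so large that these increments stay small, and \<open>radius_scale p\<close> relates the trust radius
  at index \<open>i\<close> to \<open>D * i powr (- 3 / 2)\<close>.
\<close>

definition growth :: "nat \<Rightarrow> real"
  where "growth p = 2 ^ (3 * p)"

definition first_index :: "nat \<Rightarrow> nat"
  where "first_index p = 16 * (2 ^ (3 * p))\<^sup>2 + 1"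

definition radius_scale :: "nat \<Rightarrow> real"
  where "radius_scale p = 18 * (growth p)\<^sup>2 + real (first_index p) powr ((3 * real p - 1) / 2)"

definition schedule_scale :: "nat \<Rightarrow> real"
  where "schedule_scale p = 16 * 2 ^ p * growth p * radius_scale p ^ (p - 1)"

text \<open>
  The increments are of order \<open>S i / i\<close>, that is, proportional to the power \<open>3 / 2 * (p - 1)\<close> of \<open>i\<close>. Since the
  trust radius is the power \<open>- 1 / (p - 1)\<close> of the increment, it decays like \<open>i powr (- 3 / 2)\<close> for every \<open>p\<close>.
\<close>

definition anchor_schedule :: "nat \<Rightarrow> real \<Rightarrow> real \<Rightarrow> nat \<Rightarrow> real"
  where "anchor_schedule p L D i = real i powr ((3 * real p - 1) / 2) / (schedule_scale p * L * D ^ (p - 1))"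

text \<open>
  A convex function on \<open>[0, 1]\<close> lies below its chord.
\<close>

lemma one_plus_power_le:
  fixes t :: real
  assumes "0 \<le> t" "t \<le> 1"
  shows "(1 + t) ^ n \<le> 1 + (2 ^ n - 1) * t"
proof (induction n)
  case (Suc n)
  have "(1 + t) ^ Suc n \<le> (1 + (2 ^ n - 1) * t) * (1 + t)"
    using mult_right_mono[OF Suc.IH, of "1 + t"] assms by (simp add: mult.commute)
  also have "\<dots> = 1 + 2 ^ n * t + (2 ^ n - 1) * (t * t)" by (simp add: algebra_simps)
  also have "\<dots> \<le> 1 + 2 ^ n * t + (2 ^ n - 1) * t"
    using assms by (intro add_left_mono mult_left_mono mult_left_le) auto
  finally show ?case by (simp add: algebra_simps)
qed simp

lemma growth_ge: "p \<ge> 2 \<Longrightarrow> growth p \<ge> 2"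
  using power_increasing[of 1 "3 * p" "2 :: real"] by (simp add: growth_def)

lemma powr_increment_le:
  assumes "p \<ge> 2" "i \<ge> 1"
  shows "real (Suc i) powr ((3 * real p - 1) / 2) - real i powr ((3 * real p - 1) / 2)
    \<le> growth p / real i * real i powr ((3 * real p - 1) / 2)"
proof -
  define m where "m = (3 * real p - 1) / 2"
  have "real (Suc i) = real i * (1 + 1 / real i)" using assms by (simp add: field_simps)
  then have "real (Suc i) powr m = real i powr m * (1 + 1 / real i) powr m"
    by (simp only: powr_mult)
  also have "(1 + 1 / real i) powr m \<le> (1 + 1 / real i) powr real (3 * p)"
    using assms by (intro powr_mono) (auto simp: m_def)
  also have "(1 + 1 / real i) powr real (3 * p) = (1 + 1 / real i) ^ (3 * p)"
    using assms by (intro powr_realpow) (auto intro: add_pos_nonneg)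
  also have "\<dots> \<le> 1 + (growth p - 1) * (1 / real i)"
    using one_plus_power_le[of "1 / real i" "3 * p"] assms by (simp add: growth_def)
  also have "\<dots> \<le> 1 + growth p / real i" using assms by (simp add: field_simps)
  finally have "real (Suc i) powr m \<le> real i powr m * (1 + growth p / real i)"
    by (simp add: mult_left_mono)
  then show ?thesis by (simp add: m_def algebra_simps)
qed

lemma first_index: "real (first_index p) - 1 = 16 * (growth p)\<^sup>2" "first_index p \<ge> 2"
  by (auto simp: first_index_def growth_def)

lemma radius_scale_ge:
  assumes p: "p \<ge> 2"
  shows "18 * (growth p)\<^sup>2 \<le> radius_scale p"
    and "real (first_index p) powr ((3 * real p - 1) / 2) \<le> radius_scale p"
    and "1 \<le> radius_scale p"
proof -
  show 1: "18 * (growth p)\<^sup>2 \<le> radius_scale p"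
    and "real (first_index p) powr ((3 * real p - 1) / 2) \<le> radius_scale p"
    by (auto simp: radius_scale_def)
  have "1 \<le> (growth p)\<^sup>2" using growth_ge[OF p] by (intro one_le_power) auto
  with 1 show "1 \<le> radius_scale p" by linarith
qed

lemma schedule_scale_pos: "p \<ge> 2 \<Longrightarrow> schedule_scale p > 0"
  using radius_scale_ge(3)[of p] growth_ge[of p] by (simp add: schedule_scale_def)

context
  fixes p :: nat and L D :: real
  assumes p: "p \<ge> 2" and L: "L > 0" and D: "D > 0"
begin

private abbreviation "S \<equiv> anchor_schedule p L D"

lemma schedule_pos: "i \<ge> 1 \<Longrightarrow> S i > 0"
  using schedule_scale_pos[OF p] L D by (simp add: anchor_schedule_def)

lemma schedule_strict: "S i < S (Suc i)"
  unfolding anchor_schedule_def using schedule_scale_pos[OF p] L D p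
  by (intro divide_strict_right_mono powr_less_mono2) auto

lemma schedule_ratio:
  assumes "i \<ge> 1"
  shows "(S (Suc i) - S i) / S i \<le> growth p / real i"
proof -
  have "S (Suc i) - S i \<le> growth p / real i * S i"
    using divide_right_mono[OF powr_increment_le[OF p assms], of "schedule_scale p * L * D ^ (p - 1)"] schedule_scale_pos[OF p] L D
    by (simp add: anchor_schedule_def diff_divide_distrib)
  then show ?thesis using schedule_pos[OF assms] by (simp add: pos_divide_le_eq)
qed

lemma schedule_radius:
  assumes "i \<ge> 1"
  shows "radius_scale p * D * real i powr (- 3 / 2) \<le> anchored_method.radius p L (S (Suc i) - S i)"
proof -
  define R where "R = radius_scale p"
  have R: "R \<ge> 1" using radius_scale_ge[OF p] by (simp add: R_def)
  define b where "b = real i powr (3 / 2 * (real p - 1)) / (16 * 2 ^ p * L * (R * D) ^ (p - 1))"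
  have i: "real i > 0" using assms by simp
  have "S (Suc i) - S i \<le> growth p / real i * S i"
    using schedule_ratio[OF assms] schedule_pos[OF assms] by (simp add: pos_divide_le_eq)
  also have "\<dots> = b"
  proof -
    have "real i powr ((3 * real p - 1) / 2) = real i * real i powr (3 / 2 * (real p - 1))"
      using i by (simp add: powr_mult_base field_simps)
    then show ?thesis
      using i growth_ge[OF p] by (simp add: anchor_schedule_def b_def schedule_scale_def R_def power_mult_distrib)
  qed
  finally have le: "S (Suc i) - S i \<le> b" .
  have pos: "0 < S (Suc i) - S i" using schedule_strict by simp
  have "R * D * real i powr (- 3 / 2) = (1 / (16 * 2 ^ p * L * b)) powr (1 / (real p - 1))"
  proof -
    have "1 / (16 * 2 ^ p * L * b) = (R * D) powr (real p - 1) * real i powr (- 3 / 2 * (real p - 1))"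
    proof -
      have "(R * D) ^ (p - 1) = (R * D) powr (real p - 1)"
        using R D p by (subst powr_realpow[symmetric]) (auto simp: of_nat_diff)
      moreover have "real i powr (- 3 / 2 * (real p - 1)) = 1 / real i powr (3 / 2 * (real p - 1))"
        by (simp add: powr_minus_divide)
      ultimately show ?thesis using L by (simp add: b_def)
    qed
    also have "\<dots> powr (1 / (real p - 1)) = R * D * real i powr (- 3 / 2)"
    proof -
      have "x * (1 / x) = 1" "c * x * (1 / x) = c" if "x \<noteq> 0" for c x :: real
        using that by simp_all
      from this[of "real p - 1"] show ?thesis
        using R D p by (simp only: powr_mult powr_powr) simp
    qed
    finally show ?thesis by simp
  qed
  also have "\<dots> \<le> (1 / (16 * 2 ^ p * L * (S (Suc i) - S i))) powr (1 / (real p - 1))"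
    using pos le L p by (intro powr_mono2 divide_left_mono mult_left_mono) auto
  finally show ?thesis by (simp add: anchored_method.radius_def R_def)
qed

text \<open>
  The left side decays like \<open>D / i\<^sup>2\<close>, faster than the trust radius; the first summand of \<open>radius_scale\<close> covers
  the constants.
\<close>

lemma schedule_small_displacement:
  assumes "i \<ge> 1"
  shows "(S (Suc i) - S i)\<^sup>2 * (9 * D) / (S i)\<^sup>2 \<le> anchored_method.radius p L (S (Suc i) - S i) / 2"
proof -
  have i: "real i \<ge> 1" using assms by simp
  have pos: "0 < S (Suc i) - S i" using schedule_strict by simp
  have "((S (Suc i) - S i) / S i)\<^sup>2 \<le> (growth p / real i)\<^sup>2"
    using schedule_ratio[OF assms] schedule_pos[OF assms] pos by (intro power_mono) auto
  then have "((S (Suc i) - S i) / S i)\<^sup>2 * (9 * D) \<le> (growth p / real i)\<^sup>2 * (9 * D)"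
    using D by (intro mult_right_mono) auto
  also have "\<dots> = 18 * (growth p)\<^sup>2 * D * real i powr (- 2) / 2"
    using i by (simp add: power_divide powr_minus_divide)
  also have "\<dots> \<le> radius_scale p * D * real i powr (- 3 / 2) / 2"
    using radius_scale_ge(1,3)[OF p] D i by (intro divide_right_mono mult_mono powr_mono) auto
  also have "\<dots> \<le> anchored_method.radius p L (S (Suc i) - S i) / 2"
    using schedule_radius[OF assms] by simp
  finally show ?thesis by (simp add: power_divide)
qed

text \<open>
  The ratio of the weight to its increment is of order \<open>i\<close> and the trust radius of order \<open>D * i powr (- 3 / 2)\<close>;
  the square of the product is of order \<open>D\<^sup>2 / i\<close>.
\<close>

lemma schedule_threshold:
  assumes "i \<ge> 1"
  shows "D\<^sup>2 / real i \<le> (S i * anchored_method.radius p L (S (Suc i) - S i))\<^sup>2 / (72 * (S (Suc i) - S i)\<^sup>2)"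
proof -
  define a where "a = S (Suc i) - S i"
  define M where "M = growth p"
  define R where "R = radius_scale p"
  have i: "real i \<ge> 1" using assms by simp
  have a: "0 < a" using schedule_strict by (simp add: a_def)
  have M: "M \<ge> 2" using growth_ge[OF p] by (simp add: M_def)
  have R: "18 * M\<^sup>2 \<le> R" "1 \<le> R" using radius_scale_ge[OF p] by (auto simp: R_def M_def)
  have Si: "real i / M \<le> S i / a"
    using schedule_ratio[OF assms] schedule_pos[OF assms] a M i
    by (simp add: a_def M_def field_simps)
  have "9 * M \<le> R"
  proof -
    have "2 * M \<le> M\<^sup>2" using M by (simp add: power2_eq_square)
    then show ?thesis using R(1) M by linarith
  qed
  then have "(9 * M)\<^sup>2 \<le> R\<^sup>2" using M by (intro power_mono) auto
  then have "72 * M\<^sup>2 \<le> R\<^sup>2" by (simp add: power_mult_distrib) (smt (verit) zero_le_power2)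
  then have "D\<^sup>2 / real i \<le> R\<^sup>2 / (72 * M\<^sup>2) * (D\<^sup>2 / real i)"
  proof -
    have "1 \<le> R\<^sup>2 / (72 * M\<^sup>2)" using \<open>72 * M\<^sup>2 \<le> R\<^sup>2\<close> M by (simp add: pos_le_divide_eq)
    from mult_right_mono[OF this, of "D\<^sup>2 / real i"] show ?thesis by simp
  qed
  also have "\<dots> = (real i / M * (R * D * real i powr (- 3 / 2)))\<^sup>2 / 72"
  proof -
    have "(real i powr (- 3 / 2))\<^sup>2 = 1 / real i ^ 3"
      using i by (simp add: power2_eq_square powr_add[symmetric] powr_minus_divide powr_numeral)
    then have "(real i / M * (R * D * real i powr (- 3 / 2)))\<^sup>2
        = (real i)\<^sup>2 / M\<^sup>2 * (R\<^sup>2 * D\<^sup>2 * (1 / real i ^ 3))"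
      by (simp only: power_mult_distrib power_divide)
    then show ?thesis
      using i by (simp add: power2_eq_square power3_eq_cube)
  qed
  also have "\<dots> \<le> (S i / a * anchored_method.radius p L a)\<^sup>2 / 72"
    using Si schedule_radius[OF assms] i M R D a schedule_pos[OF assms]
    by (intro divide_right_mono power_mono mult_mono) (auto simp: R_def a_def)
  finally show ?thesis by (simp add: a_def power_mult_distrib power_divide)
qed

text \<open>
  This is what the second summand of \<open>radius_scale\<close> is for.
\<close>

lemma schedule_start: "S (first_index p) * (L * D ^ p) \<le> D"
proof -
  define R where "R = radius_scale p"
  have R: "1 \<le> R" "real (first_index p) powr ((3 * real p - 1) / 2) \<le> R" 
    using radius_scale_ge[OF p] by (auto simp: R_def)
  have "R \<le> R ^ (p - 1)" using power_increasing[of 1 "p - 1" R] R p by simp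
  also have "\<dots> = 1 * R ^ (p - 1)" by simp
  also have "\<dots> \<le> (16 * 2 ^ p * growth p) * R ^ (p - 1)"
  proof -
    have "1 \<le> (2 :: real) ^ p" by simp
    then have "1 * 1 \<le> (16 * 2 ^ p) * growth p"
      using growth_ge[OF p] by (intro mult_mono) (linarith | simp)+
    then show ?thesis using R by (intro mult_right_mono) auto
  qed
  finally have "real (first_index p) powr ((3 * real p - 1) / 2) \<le> schedule_scale p"
    using R by (simp add: schedule_scale_def R_def)
  then have "real (first_index p) powr ((3 * real p - 1) / 2) / schedule_scale p \<le> 1"
    using schedule_scale_pos[OF p] by simp
  then have "real (first_index p) powr ((3 * real p - 1) / 2) / schedule_scale p * D \<le> 1 * D"
    using D by (intro mult_right_mono) auto
  moreover have "D ^ p = D ^ (p - 1) * D" using p by (simp flip: power_Suc2)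
  ultimately show ?thesis
    using L D by (simp add: anchor_schedule_def)
qed

end

definition horizon :: "nat \<Rightarrow> real \<Rightarrow> nat"
  where "horizon p Q = first_index p + nat \<lceil>(9 * schedule_scale p * Q) powr (2 / (3 * real p - 1))\<rceil>"

lemma horizon_sufficient:
  assumes "p \<ge> 2" "L > 0" "D > 0" "\<epsilon> > 0"
  shows "9 * D \<le> anchor_schedule p L D (horizon p (L * D ^ p / \<epsilon>)) * \<epsilon>"
proof -
  define m where "m = (3 * real p - 1) / 2"
  have m: "m > 0" "2 / (3 * real p - 1) = 1 / m" using assms by (auto simp: m_def)
  define q where "q = 9 * schedule_scale p * (L * D ^ p / \<epsilon>)"
  have q: "q > 0" using assms schedule_scale_pos by (simp add: q_def)
  have "q powr (1 / m) \<le> real (horizon p (L * D ^ p / \<epsilon>))"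
    unfolding horizon_def m(2) q_def by linarith
  then have "(q powr (1 / m)) powr m \<le> real (horizon p (L * D ^ p / \<epsilon>)) powr m"
    using m by (intro powr_mono2) auto
  then have "q \<le> real (horizon p (L * D ^ p / \<epsilon>)) powr m"
    using m q by (simp add: powr_powr)
  moreover have "q = 9 * D * (schedule_scale p * L * D ^ (p - 1)) / \<epsilon>"
  proof -
    have "D ^ p = D ^ (p - 1) * D" using assms(1) by (simp flip: power_Suc2)
    then show ?thesis by (simp add: q_def)
  qed
  moreover have "0 < schedule_scale p * L * D ^ (p - 1)" using assms schedule_scale_pos by simp
  ultimately show ?thesis
    unfolding anchor_schedule_def m_def[symmetric] using assms(4) by (simp add: field_simps)
qed

lemma horizon_le:
  assumes "p \<ge> 2" "Q > 0"
  shows "real (horizon p Q) \<le> (real (first_index p) + 1 + (9 * schedule_scale p) powr (2 / (3 * real p - 1)))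
    * max 1 (Q powr (2 / (3 * real p - 1)))"
proof -
  define t where "t = 2 / (3 * real p - 1)"
  define c where "c = (9 * schedule_scale p) powr t"
  have sc: "schedule_scale p \<ge> 0" unfolding schedule_scale_def radius_scale_def growth_def by simp
  have "real (horizon p Q) \<le> real (first_index p) + 1 + c * Q powr t"
    unfolding horizon_def t_def[symmetric] c_def
    using assms sc by (simp add: powr_mult of_nat_nat) linarith
  also have "\<dots> \<le> (real (first_index p) + 1) * max 1 (Q powr t) + c * max 1 (Q powr t)"
  proof (rule add_mono)
    show "real (first_index p) + 1 \<le> (real (first_index p) + 1) * max 1 (Q powr t)"
      using mult_left_mono[of 1 "max 1 (Q powr t)" "real (first_index p) + 1"] by simp
    show "c * Q powr t \<le> c * max 1 (Q powr t)" by (intro mult_left_mono) (auto simp: c_def)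
  qed
  finally show ?thesis by (simp add: t_def c_def algebra_simps)
qed

section \<open>The complexity bound\<close>

theorem theorem3p1:
  fixes p :: nat
  assumes "p \<ge> 2"
  shows "\<exists>C>0::real. \<exists>alg :: algorithm.
    \<forall>(d::nat) (X :: fvec set) (F :: fvec \<Rightarrow> fvec) (DF :: nat \<Rightarrow> fvec \<Rightarrow> tensor)
      (L::real) (D::real) (xs::fvec) (x0::fvec) (\<epsilon>::real).
      X \<subseteq> Rn d \<longrightarrow> X \<noteq> {} \<longrightarrow> compact X \<longrightarrow> convex X \<longrightarrow>
      F ` Rn d \<subseteq> Rn d \<longrightarrow> continuous_on (Rn d) F \<longrightarrow>
      monotone_operator_on X F \<longrightarrow>
      L > 0 \<longrightarrow> smooth_operator_on d X p L F DF \<longrightarrow>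
      xs \<in> X \<longrightarrow> 0 \<in> VI_residual_set d X F xs \<longrightarrow>
      x0 \<in> X \<longrightarrow> D = norm (x0 - xs) \<longrightarrow> D > 0 \<longrightarrow> \<epsilon> > 0 \<longrightarrow>
      (\<exists>T x. returns (Rn d) (jet_oracle p DF) (alg d L D X x0 \<epsilon>) [] T x \<and>
        x \<in> X \<and> infdist 0 (VI_residual_set d X F x) \<le> \<epsilon> \<and>
        real T \<le> C * max 1 ((L * D ^ p / \<epsilon>) powr (2 / (3 * real p - 1))))"
proof -
  define k where "k = first_index p"
  define alg :: algorithm where "alg = (\<lambda>d L D X x0 \<epsilon>.
    anchored_method.strategy d p L D X x0 (anchor_schedule p L D k)
      (map (\<lambda>i. anchor_schedule p L D (Suc i) - anchor_schedule p L D i)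
        [k..<horizon p (L * D ^ p / \<epsilon>)]))"
  define C where "C = 963 * (real k + 1 + (9 * schedule_scale p) powr (2 / (3 * real p - 1)))"
  show ?thesis
  proof (rule exI[of _ C], intro conjI exI[of _ alg] allI impI)
    show "C > 0" unfolding C_def by (intro mult_pos_pos add_nonneg_pos add_pos_nonneg) auto
    fix d X F DF L D xs x0 and \<epsilon> :: real
    assume X: "X \<subseteq> Rn d" "X \<noteq> {}" "compact X" "convex X"
      and F: "F ` Rn d \<subseteq> Rn d" "continuous_on (Rn d) F" "monotone_operator_on X F"
      and L: "L > 0" and smooth: "smooth_operator_on d X p L F DF"
      and xs: "xs \<in> X" "0 \<in> VI_residual_set d X F xs"
      and x0: "x0 \<in> X" and D: "D = norm (x0 - xs)" "D > 0" and eps: "\<epsilon> > 0"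
    interpret anchored_method_analysis d p L D X x0 F DF xs
      by unfold_locales (use assms X F L smooth xs x0 D in auto)
    define K where "K = horizon p (L * D ^ p / \<epsilon>)"
    note k = first_index[of p, folded k_def]
    have ge1: "i \<ge> 1" if "i \<ge> k" for i using that k by linarith
    have four: "4 * (anchor_schedule p L D (Suc i) - anchor_schedule p L D i) \<le> anchor_schedule p L D i"
      if "i \<ge> k" for i
    proof -
      have "4 * growth p \<le> real i"
      proof -
        have "2 * growth p \<le> (growth p)\<^sup>2" using growth_ge[OF assms] by (simp add: power2_eq_square)
        moreover have "real k \<le> real i" using that by simp
        ultimately show ?thesis using k(1) growth_ge[OF assms] by linarith
      qed
      then have "4 * (growth p / real i) \<le> 1"
        using ge1[OF that] by simp
      with schedule_ratio[OF assms L D(2) ge1[OF that]]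
      have "4 * ((anchor_schedule p L D (Suc i) - anchor_schedule p L D i) / anchor_schedule p L D i) \<le> 1"
        by linarith
      then show ?thesis using schedule_pos[OF assms L D(2) ge1[OF that]] by simp
    qed
    have "\<exists>T x. returns (Rn d) (jet_oracle p DF) (strategy (anchor_schedule p L D k)
        (map (\<lambda>i. anchor_schedule p L D (Suc i) - anchor_schedule p L D i) [k..<K])) [] T x \<and>
      x \<in> X \<and> infdist 0 (VI_residual_set d X F x) \<le> \<epsilon> \<and> real T \<le> 963 * real K"
    proof (rule strategy_returns_solution[where M = "growth p"])
      show "anchor_schedule p L D k * (L * D ^ p) \<le> D"
        using schedule_start[OF assms L D(2)] by (simp add: k_def)
      show "9 * D \<le> anchor_schedule p L D K * \<epsilon>"
        unfolding K_def by (rule horizon_sufficient[OF assms L D(2) eps])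
      show "k \<le> K" by (simp add: K_def horizon_def k_def)
    qed (use k four ge1 schedule_pos[OF assms L D(2)] schedule_strict[OF assms L D(2)]
        schedule_ratio[OF assms L D(2)] schedule_small_displacement[OF assms L D(2)]
        schedule_threshold[OF assms L D(2)] in \<open>auto simp: threshold_def\<close>)
    moreover have "963 * real K \<le> C * max 1 ((L * D ^ p / \<epsilon>) powr (2 / (3 * real p - 1)))"
      unfolding C_def K_def k_def mult.assoc
      by (intro mult_left_mono horizon_le[OF assms]) (use L D eps in simp_all)
    ultimately show "\<exists>T x. returns (Rn d) (jet_oracle p DF) (alg d L D X x0 \<epsilon>) [] T x \<and>
        x \<in> X \<and> infdist 0 (VI_residual_set d X F x) \<le> \<epsilon> \<and>
        real T \<le> C * max 1 ((L * D ^ p / \<epsilon>) powr (2 / (3 * real p - 1)))"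
      unfolding alg_def K_def by (meson order_trans)
  qed
qed

end
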